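(* Let $f_0,\dots,f_m\colon\{-1,1\}^n\to\mathbb R$ and $g_0,\dots,g_n\colon\{-1,1\}^m\to\mathbb R$ form a multilinear generalized polymorphism, i.e. for all $z\in\{-1,1\}^{[n]\times[m]}$, $f_0(g_1(z_{1\cdot}),\dots,g_n(z_{n\cdot}))=g_0(f_1(z_{\cdot1}),\dots,f_m(z_{\cdot m}))$ with $z_{i\cdot}=(z_{i1},\dots,z_{im})$, $z_{\cdot j}=(z_{1j},\dots,z_{nj})$. Suppose $f_0,g_0$ depend on all their inputs, all of $f_0,\dots,f_m,g_0,\dots,g_n$ have degree at least $2$, and $f_1,\dots,f_m,g_1,\dots,g_n$ are 2-valued-like. Then there exist a set $Z_0\subseteq[n]\times[m]$, a partition $Z_0=Z_1\sqcup\dots\sqcup Z_k$ into parts pairwise disjoint in rows and in columns, a function $h\colon\{-1,1\}^k\to\mathbb R$ (identified with its multilinear extension to $\mathbb R^k$), real constants $A_j,B_j$ ($j\in[m]$), $C_i,D_i$ ($i\in[n]$) and $\kappa_{ij}$ ($(i,j)\in Z_0$) such that $f_0(x)=h\Big(\prod_{i\in\mathrm{rows}(Z_1)}\frac{x_i-D_i}{C_i},\dots,\prod_{i\in\mathrm{rows}(Z_k)}\frac{x_i-D_i}{C_i}\Big)$, $f_j(x)=A_j\prod_{i\in\mathrm{Dep}(f_j)}(x_i+\kappa_{ij})+B_j$, $g_0(y)=h\Big(\prod_{j\in\mathrm{cols}(Z_1)}\frac{y_j-B_j}{A_j},\dots,\prod_{j\in\mathrm{cols}(Z_k)}\frac{y_j-B_j}{A_j}\Big)$,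 $g_i(y)=C_i\prod_{j\in\mathrm{Dep}(g_i)}(y_j+\kappa_{ij})+D_i$.
   Context: Every $f\colon\{-1,1\}^n\to\mathbb R$ is identified with its unique multilinear expansion $f(x)=\sum_{S\subseteq[n]}\hat f(S)\prod_{i\in S}x_i$; $\mathrm{supp}(\hat f)=\{S:\hat f(S)\ne0\}$; $\deg f$ is its degree; $\mathrm{Dep}(f)$ is the set of coordinates $f$ depends on. A dictator is a non-constant function depending on exactly one coordinate. $f$ is 2-valued-like if (a) $\deg f=1$ iff $f$ is a dictator, and (b) if $f$ is not a dictator then for every $w\in\mathrm{Dep}(f)$ some $S\in\mathrm{supp}(\hat f)$ with $|S|\ge2$ contains $w$. For $W\subseteq[n]\times[m]$, $\mathrm{rows}(W)$ and $\mathrm{cols}(W)$ are its projections onto the first and second coordinate. *)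

theory Defs
  imports Complex_Main "HOL-Library.FuncSet"
begin

text \<open>
  A function \<open>{-1,1}\<^sup>I \<rightarrow> \<real>\<close>, \<open>I\<close> a finite index set, is a HOL function of type
  \<open>('i \<Rightarrow> real) \<Rightarrow> real\<close> of which only the values on \<open>sign_cube I\<close> matter; all notions
  below look at these values only.
\<close>

definition sign_cube :: "'i set \<Rightarrow> ('i \<Rightarrow> real) set" where
  "sign_cube I = (I \<rightarrow>\<^sub>E {-1, 1})"

text \<open>
  The coefficients of the multilinear expansion, given by Fourier inversion; that they are
  the coefficients of the unique multilinear expansion is shown in \<open>mlext_sign_cube\<close> and
  \<open>fourier_coeff_unique\<close>.
\<close>

definition fourier_coeff :: "'i set \<Rightarrow> (('i \<Rightarrow> real) \<Rightarrow> real) \<Rightarrow> 'i set \<Rightarrow> real" where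
  "fourier_coeff I f S = (\<Sum>x\<in>sign_cube I. f x * (\<Prod>i\<in>S. x i)) / 2 ^ card I"

definition mlext :: "'i set \<Rightarrow> (('i \<Rightarrow> real) \<Rightarrow> real) \<Rightarrow> ('i \<Rightarrow> real) \<Rightarrow> real" where
  "mlext I f x = (\<Sum>S\<in>Pow I. fourier_coeff I f S * (\<Prod>i\<in>S. x i))"

definition fourier_supp :: "'i set \<Rightarrow> (('i \<Rightarrow> real) \<Rightarrow> real) \<Rightarrow> 'i set set" where
  "fourier_supp I f = {S. S \<subseteq> I \<and> fourier_coeff I f S \<noteq> 0}"

text \<open>The zero function gets degree 0.\<close>

definition ml_degree :: "'i set \<Rightarrow> (('i \<Rightarrow> real) \<Rightarrow> real) \<Rightarrow> nat" where
  "ml_degree I f = Max (insert 0 (card ` fourier_supp I f))"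

definition Dep :: "'i set \<Rightarrow> (('i \<Rightarrow> real) \<Rightarrow> real) \<Rightarrow> 'i set" where
  "Dep I f = {i \<in> I. \<exists>x\<in>sign_cube I. f (x(i := 1)) \<noteq> f (x(i := -1))}"

definition dictator :: "'i set \<Rightarrow> (('i \<Rightarrow> real) \<Rightarrow> real) \<Rightarrow> bool" where
  "dictator I f \<longleftrightarrow>
     (\<exists>x\<in>sign_cube I. \<exists>y\<in>sign_cube I. f x \<noteq> f y) \<and> (\<exists>!i. i \<in> Dep I f)"

definition two_valued_like :: "'i set \<Rightarrow> (('i \<Rightarrow> real) \<Rightarrow> real) \<Rightarrow> bool" where
  "two_valued_like I f \<longleftrightarrow>
     (ml_degree I f = 1 \<longleftrightarrow> dictator I f) \<and>
     (\<not> dictator I f \<longrightarrow> (\<forall>w\<in>Dep I f. \<exists>S\<in>fourier_supp I f. card S \<ge> 2 \<and> w \<in> S))"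

text \<open>
  The inner functions are evaluated at sign vectors, so only the outer functions
  \<open>f 0\<close> and \<open>g 0\<close> need their multilinear extensions.
\<close>

definition ml_gen_polymorphism ::
    "nat \<Rightarrow> nat \<Rightarrow> (nat \<Rightarrow> (nat \<Rightarrow> real) \<Rightarrow> real) \<Rightarrow> (nat \<Rightarrow> (nat \<Rightarrow> real) \<Rightarrow> real) \<Rightarrow> bool" where
  "ml_gen_polymorphism n m f g \<longleftrightarrow>
     (\<forall>z\<in>sign_cube ({1..n} \<times> {1..m}).
        mlext {1..n} (f 0) (\<lambda>i. g i (\<lambda>j\<in>{1..m}. z (i, j))) =
        mlext {1..m} (g 0) (\<lambda>j. f j (\<lambda>i\<in>{1..n}. z (i, j))))"

lemma finite_sign_cube: "finite I \<Longrightarrow> finite (sign_cube I)"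
  unfolding sign_cube_def by (intro finite_PiE) auto

lemma sign_cube_nth: "x \<in> sign_cube I \<Longrightarrow> i \<in> I \<Longrightarrow> x i = 1 \<or> x i = -1"
  unfolding sign_cube_def by (auto simp: PiE_iff)

theorem mlext_sign_cube:
  assumes "finite I" "y \<in> sign_cube I"
  shows "mlext I f y = f y"
proof -
  have kernel: "(\<Sum>S\<in>Pow I. (\<Prod>i\<in>S. x i) * (\<Prod>i\<in>S. y i)) = (if x = y then 2 ^ card I else 0)"
    if x: "x \<in> sign_cube I" for x
  proof -
    have "(\<Sum>S\<in>Pow I. (\<Prod>i\<in>S. x i) * (\<Prod>i\<in>S. y i)) = (\<Prod>i\<in>I. x i * y i + 1)"
      by (subst prod_add[OF assms(1)]) (simp add: prod.distrib)
    also have "\<dots> = (if x = y then 2 ^ card I else 0)"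
    proof (cases "x = y")
      case True
      have "(\<Prod>i\<in>I. x i * y i + 1) = (\<Prod>i\<in>I. 2)"
        by (intro prod.cong refl) (use True sign_cube_nth[OF x] in fastforce)
      with True show ?thesis by simp
    next
      case False
      then obtain i where i: "i \<in> I" "x i \<noteq> y i"
        using x assms(2) unfolding sign_cube_def by (metis PiE_ext)
      then have "x i * y i + 1 = 0"
        using sign_cube_nth[OF x, of i] sign_cube_nth[OF assms(2), of i] by auto
      with i assms(1) False show ?thesis by (auto intro: prod_zero)
    qed
    finally show ?thesis .
  qed
  have "mlext I f y = (\<Sum>S\<in>Pow I. \<Sum>x\<in>sign_cube I.
          f x / 2 ^ card I * ((\<Prod>i\<in>S. x i) * (\<Prod>i\<in>S. y i)))"
    unfolding mlext_def fourier_coeff_def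
    by (simp add: sum_distrib_right sum_distrib_left sum_divide_distrib mult_ac)
  also have "\<dots> = (\<Sum>x\<in>sign_cube I. f x / 2 ^ card I *
          (\<Sum>S\<in>Pow I. (\<Prod>i\<in>S. x i) * (\<Prod>i\<in>S. y i)))"
    by (subst sum.swap) (simp add: sum_distrib_left)
  also have "\<dots> = (\<Sum>x\<in>sign_cube I. if x = y then f y else 0)"
    by (intro sum.cong refl) (simp add: kernel)
  also have "\<dots> = f y"
    using finite_sign_cube[OF assms(1)] assms(2) by simp
  finally show ?thesis .
qed

lemma sign_cube_orthogonal:
  assumes "finite I" "S \<subseteq> I" "T \<subseteq> I"
  shows "(\<Sum>x\<in>sign_cube I. (\<Prod>i\<in>S. x i) * (\<Prod>i\<in>T. x i)) = (if S = T then 2 ^ card I else 0)"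
proof -
  define u :: "'a \<Rightarrow> real \<Rightarrow> real"
    where "u i t = (if i \<in> S then t else 1) * (if i \<in> T then t else 1)" for i t
  have "(\<Prod>i\<in>S. x i) * (\<Prod>i\<in>T. x i) = (\<Prod>i\<in>I. u i (x i))" for x :: "'a \<Rightarrow> real"
  proof -
    have "(\<Prod>i\<in>I. if i \<in> R then x i else 1) = (\<Prod>i\<in>R. x i)" if "R \<subseteq> I" for R
      using prod.inter_restrict[OF assms(1), of x R] that by (simp add: Int_absorb1)
    then show ?thesis using assms by (simp add: u_def prod.distrib)
  qed
  then have "(\<Sum>x\<in>sign_cube I. (\<Prod>i\<in>S. x i) * (\<Prod>i\<in>T. x i))
      = (\<Sum>x\<in>I \<rightarrow>\<^sub>E {-1, 1}. \<Prod>i\<in>I. u i (x i))"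
    by (simp add: sign_cube_def)
  also have "\<dots> = (\<Prod>i\<in>I. \<Sum>t\<in>{-1, 1}. u i t)"
    using assms(1) by (subst prod_sum_PiE) auto
  also have "\<dots> = (\<Prod>i\<in>I. if i \<in> S \<longleftrightarrow> i \<in> T then 2 else 0)"
    by (intro prod.cong refl) (auto simp: u_def)
  also have "\<dots> = (if S = T then 2 ^ card I else 0)"
  proof (cases "S = T")
    case False
    then obtain i where "i \<in> I" "\<not> (i \<in> S \<longleftrightarrow> i \<in> T)" using assms by blast
    with assms(1) False show ?thesis by (auto intro!: prod_zero bexI[of _ i])
  qed simp
  finally show ?thesis .
qed

theorem fourier_coeff_unique:
  assumes "finite I" "\<And>x. x \<in> sign_cube I \<Longrightarrow> f x = (\<Sum>S\<in>Pow I. c S * (\<Prod>i\<in>S. x i))"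
    and "T \<subseteq> I"
  shows "fourier_coeff I f T = c T"
proof -
  have "(\<Sum>x\<in>sign_cube I. f x * (\<Prod>i\<in>T. x i))
      = (\<Sum>x\<in>sign_cube I. \<Sum>S\<in>Pow I. c S * ((\<Prod>i\<in>S. x i) * (\<Prod>i\<in>T. x i)))"
    by (intro sum.cong refl) (simp add: assms(2) sum_distrib_right sum_distrib_left mult_ac)
  also have "\<dots> = (\<Sum>S\<in>Pow I. c S * (\<Sum>x\<in>sign_cube I. (\<Prod>i\<in>S. x i) * (\<Prod>i\<in>T. x i)))"
    by (subst sum.swap) (simp add: sum_distrib_left)
  also have "\<dots> = (\<Sum>S\<in>Pow I. if S = T then c T * 2 ^ card I else 0)"
    by (intro sum.cong refl) (use assms(1,3) in \<open>auto simp: sign_cube_orthogonal\<close>)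
  also have "\<dots> = c T * 2 ^ card I"
    using assms(1,3) by simp
  finally show ?thesis by (simp add: fourier_coeff_def)
qed

end

theory Submission
  imports Defs
begin

text \<open>
  Both sides of the polymorphism identity are affine in every \<open>z\<^sub>i\<^sub>j\<close>, so it holds for all real \<open>z\<close>
  and can be expanded around a generic point. There every Taylor coefficient that is not forced
  to vanish is nonzero, so the supports of \<open>f\<^sub>0\<close>, \<open>g\<^sub>0\<close>, \<open>f\<^sub>j\<close>, \<open>g\<^sub>i\<close> become simplicial complexes, and
  comparing the coefficients of \<open>\<Prod>(i,j)\<in>W. z\<^sub>i\<^sub>j\<close> gives, for every \<open>W\<close>,
  \<open>a (rows W) \<cdot> (\<Prod>i. b\<^sub>i (row i of W)) = c (cols W) \<cdot> (\<Prod>j. d\<^sub>j (column j of W))\<close>.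
  Singletons \<open>W\<close> show that \<open>j \<in> Dep g\<^sub>i\<close> iff \<open>i \<in> Dep f\<^sub>j\<close>, which defines a bipartite graph \<open>Z\<^sub>0\<close>.
  Since every vertex lies in an edge of its complex, hook-shaped \<open>W\<close> force the complexes of the
  \<open>g\<^sub>i\<close> and \<open>f\<^sub>j\<close> to be full simplices and their coefficients to be multiplicative up to one ratio
  per connected component, which is the product form of \<open>g\<^sub>i\<close> and \<open>f\<^sub>j\<close>. After this normalisation the
  identity says that \<open>a(rows W) = c(cols W)\<close> for all \<open>W \<subseteq> Z\<^sub>0\<close>; hence both depend only on which
  components \<open>W\<close> meets, and this function of sets of components is \<open>h\<close>.
\<close>

section \<open>Functions that are affine in every coordinate\<close>

text \<open>Affinity along each coordinate line replaces a coefficient-based notion, so that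
  compositions can be handled by plain substitution.\<close>

definition multiaffine :: "'i set \<Rightarrow> (('i \<Rightarrow> real) \<Rightarrow> real) \<Rightarrow> bool" where
  "multiaffine I p \<longleftrightarrow> (\<forall>i\<in>I. \<forall>x. \<exists>\<alpha> \<beta>. \<forall>t. p (x(i := t)) = \<alpha> + \<beta> * t)"

text \<open>Points are total functions, so that the value is determined by the coordinates in
  \<open>I\<close> has to be demanded separately from \<open>multiaffine\<close>.\<close>

definition depends_only :: "'i set \<Rightarrow> (('i \<Rightarrow> real) \<Rightarrow> real) \<Rightarrow> bool" where
  "depends_only I p \<longleftrightarrow> (\<forall>x y. (\<forall>i\<in>I. x i = y i) \<longrightarrow> p x = p y)"

lemma multiaffineI:
  assumes "\<And>i x. i \<in> I \<Longrightarrow> \<exists>\<alpha> \<beta>. \<forall>t. p (x(i := t)) = \<alpha> + \<beta> * t"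
  shows "multiaffine I p"
  using assms unfolding multiaffine_def by blast

lemma multiaffineD:
  assumes "multiaffine I p" "i \<in> I"
  shows "\<exists>\<alpha> \<beta>. \<forall>t. p (x(i := t)) = \<alpha> + \<beta> * t"
  using assms unfolding multiaffine_def by blast

lemma depends_onlyD:
  assumes "depends_only I p" "\<And>i. i \<in> I \<Longrightarrow> x i = y i"
  shows "p x = p y"
  using assms unfolding depends_only_def by blast

lemma multiaffine_fix:
  assumes "multiaffine (insert i I) p" "i \<notin> I"
  shows "multiaffine I (\<lambda>x. p (x(i := s)))"
proof (rule multiaffineI)
  fix k x assume k: "k \<in> I"
  then have "(x(k := t))(i := s) = (x(i := s))(k := t)" for t
    using assms(2) by (auto simp: fun_eq_iff)
  then show "\<exists>\<alpha> \<beta>. \<forall>t. p ((x(k := t))(i := s)) = \<alpha> + \<beta> * t"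
    using assms(1) k unfolding multiaffine_def by simp
qed

text \<open>An affine function of one real variable is determined by its values at 1 and -1; the
  induction frees the coordinates one at a time. This carries identities from sign vectors to all
  real points.\<close>

lemma multiaffine_eqI:
  assumes "finite I" "multiaffine I p" "multiaffine I q"
    and "\<And>x. (\<And>i. i \<in> I \<Longrightarrow> x i = 1 \<or> x i = -1) \<Longrightarrow> p x = q x"
  shows "p x = q x"
  using assms
proof (induction I arbitrary: x rule: finite_induct)
  case (insert i I)
  have "p y = q y" if y: "\<And>k. k \<in> I \<Longrightarrow> y k = 1 \<or> y k = -1" for y
  proof -
    obtain \<alpha> \<beta> where p: "\<And>t. p (y(i := t)) = \<alpha> + \<beta> * t"
      using multiaffineD[OF insert.prems(1) insertI1, where x = y] by blast
    obtain \<alpha>' \<beta>' where q: "\<And>t. q (y(i := t)) = \<alpha>' + \<beta>' * t"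
      using multiaffineD[OF insert.prems(2) insertI1, where x = y] by blast
    have "p (y(i := 1)) = q (y(i := 1))" "p (y(i := -1)) = q (y(i := -1))"
      by (rule insert.prems(3); use y in fastforce)+
    then have "\<alpha> + \<beta> = \<alpha>' + \<beta>'" "\<alpha> - \<beta> = \<alpha>' - \<beta>'"
      unfolding p q by simp_all
    then have "\<alpha> = \<alpha>'" "\<beta> = \<beta>'" by simp_all
    then show ?thesis using p[of "y i"] q[of "y i"] by simp
  qed
  moreover have "multiaffine I p" "multiaffine I q"
    using insert.prems(1,2) unfolding multiaffine_def by auto
  ultimately show ?case using insert.IH by blast
qed auto

text \<open>Each \<open>p\<close> gets its own value \<open>s p\<close> of coordinate
  \<open>i\<close> at which it is still not identically zero, and the induction hypothesis finds a
  common point for these restrictions. On the line through that point in direction \<open>i\<close>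
  every \<open>p\<close> is then a nonzero affine function with at most one root, and finitely many
  roots can be avoided.\<close>

lemma multiaffine_common_nonzero:
  fixes P :: "(('i \<Rightarrow> real) \<Rightarrow> real) set"
  assumes "finite I" "finite P"
    and "\<And>p. p \<in> P \<Longrightarrow> multiaffine I p" "\<And>p. p \<in> P \<Longrightarrow> depends_only I p"
    and "\<And>p. p \<in> P \<Longrightarrow> \<exists>x. p x \<noteq> 0"
  shows "\<exists>x. \<forall>p\<in>P. p x \<noteq> 0"
  using assms
proof (induction I arbitrary: P rule: finite_induct)
  case empty
  then have "p x = p y" if "p \<in> P" for p x y
    using that depends_onlyD by (metis empty_iff)
  then show ?case using empty.prems(4) by metis
next
  case (insert i I)
  have "\<forall>p\<in>P. \<exists>s x. p (x(i := s)) \<noteq> 0"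
    using insert.prems(4) fun_upd_triv by metis
  then obtain s where s: "\<And>p. p \<in> P \<Longrightarrow> \<exists>x. p (x(i := s p)) \<noteq> 0"
    by metis
  have "\<exists>x. \<forall>q\<in>(\<lambda>p x. p (x(i := s p))) ` P. q x \<noteq> 0"
  proof (rule insert.IH)
    fix q assume "q \<in> (\<lambda>p x. p (x(i := s p))) ` P"
    then obtain p where p: "p \<in> P" "q = (\<lambda>x. p (x(i := s p)))" by auto
    show "multiaffine I q"
      unfolding p(2) using multiaffine_fix[OF insert.prems(2)[OF p(1)] insert.hyps(2)] .
    show "depends_only I q"
      using insert.prems(3)[OF p(1)] unfolding p(2) depends_only_def by simp
    show "\<exists>x. q x \<noteq> 0" using s p by simp
  qed (use insert.prems in auto)
  then obtain x where x: "\<And>p. p \<in> P \<Longrightarrow> p (x(i := s p)) \<noteq> 0" by auto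
  have "finite {t. p (x(i := t)) = 0}" if pP: "p \<in> P" for p
  proof -
    obtain \<alpha> \<beta> where p: "\<And>t. p (x(i := t)) = \<alpha> + \<beta> * t"
      using multiaffineD[OF insert.prems(2)[OF pP] insertI1, where x = x] by blast
    have "\<alpha> \<noteq> 0 \<or> \<beta> \<noteq> 0" using x[OF pP] unfolding p by auto
    \<comment> \<open>For \<open>\<beta> = 0\<close> the quotient is 0 by convention; this is
      harmless, because then \<open>\<alpha> \<noteq> 0\<close> and there is no root.\<close>
    then have "{t. p (x(i := t)) = 0} \<subseteq> {- \<alpha> / \<beta>}"
      unfolding p by (cases "\<beta> = 0") (auto simp: field_simps add_eq_0_iff)
    then show ?thesis by (rule finite_subset) simp
  qed
  then have "finite (\<Union>p\<in>P. {t. p (x(i := t)) = 0})" using insert.prems(1) by blast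
  then obtain t where "t \<notin> (\<Union>p\<in>P. {t. p (x(i := t)) = 0})"
    using ex_new_if_finite[OF infinite_UNIV_char_0] by metis
  then show ?case by blast
qed

text \<open>At most one factor contains a given coordinate. General affine factors are allowed
  because \<open>h\<close> will be a sum of products of such factors.\<close>

lemma multiaffine_prod:
  assumes "finite S"
  shows "multiaffine I (\<lambda>x. \<Prod>i\<in>S. \<alpha> i * x i + \<beta> i)"
proof (rule multiaffineI)
  fix i and x :: "'a \<Rightarrow> real"
  let ?c = "\<Prod>k\<in>S - {i}. \<alpha> k * x k + \<beta> k"
  show "\<exists>\<gamma> \<delta>. \<forall>t. (\<Prod>k\<in>S. \<alpha> k * (x(i := t)) k + \<beta> k) = \<gamma> + \<delta> * t"
  proof (cases "i \<in> S")
    case True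
    then have "(\<Prod>k\<in>S. \<alpha> k * (x(i := t)) k + \<beta> k) = \<beta> i * ?c + (\<alpha> i * ?c) * t" for t
      using assms by (subst prod.remove[of _ i]) (auto simp: algebra_simps)
    then show ?thesis by blast
  next
    case False
    then have "(\<Prod>k\<in>S. \<alpha> k * (x(i := t)) k + \<beta> k) = (\<Prod>k\<in>S. \<alpha> k * x k + \<beta> k) + 0 * t" for t
      by (auto intro!: prod.cong)
    then show ?thesis by blast
  qed
qed

lemma multiaffine_cmult:
  assumes "multiaffine I p"
  shows "multiaffine I (\<lambda>x. c * p x)"
proof (rule multiaffineI)
  fix i x assume "i \<in> I"
  then obtain \<alpha> \<beta> where "\<And>t. p (x(i := t)) = \<alpha> + \<beta> * t"
    using multiaffineD[OF assms] by blast
  then show "\<exists>\<alpha> \<beta>. \<forall>t. c * p (x(i := t)) = \<alpha> + \<beta> * t"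
    by (intro exI[of _ "c * \<alpha>"] exI[of _ "c * \<beta>"]) (simp add: algebra_simps)
qed

lemma multiaffine_sum:
  assumes "\<And>s. s \<in> A \<Longrightarrow> multiaffine I (p s)"
  shows "multiaffine I (\<lambda>x. \<Sum>s\<in>A. p s x)"
proof (rule multiaffineI)
  fix i x assume "i \<in> I"
  then have "\<forall>s\<in>A. \<exists>\<alpha> \<beta>. \<forall>t. p s (x(i := t)) = \<alpha> + \<beta> * t"
    using assms unfolding multiaffine_def by blast
  then obtain \<alpha> \<beta> where "\<And>s t. s \<in> A \<Longrightarrow> p s (x(i := t)) = \<alpha> s + \<beta> s * t"
    by metis
  then have "(\<Sum>s\<in>A. p s (x(i := t))) = sum \<alpha> A + sum \<beta> A * t" for t
    by (simp add: sum.distrib sum_distrib_right)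
  then show "\<exists>\<alpha> \<beta>. \<forall>t. (\<Sum>s\<in>A. p s (x(i := t))) = \<alpha> + \<beta> * t" by blast
qed

lemma multiaffine_polynomial:
  assumes "\<And>S. S \<in> \<A> \<Longrightarrow> finite S"
  shows "multiaffine I (\<lambda>x. \<Sum>S\<in>\<A>. c S * (\<Prod>i\<in>S. x i))"
proof (intro multiaffine_sum multiaffine_cmult)
  show "multiaffine I (\<lambda>x. \<Prod>i\<in>S. x i)" if "S \<in> \<A>" for S
    using multiaffine_prod[OF assms[OF that], of I "\<lambda>_. 1" "\<lambda>_. 0"] by simp
qed

text \<open>Each coordinate of \<open>z\<close> enters exactly one of the inner functions, so the composition
  stays affine in it.\<close>

lemma multiaffine_compose_rows:
  assumes "multiaffine I p" "\<And>i. i \<in> I \<Longrightarrow> multiaffine J (q i)"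
  shows "multiaffine (I \<times> J) (\<lambda>z. p (\<lambda>i. q i (\<lambda>j. z (i, j))))"
proof (rule multiaffineI)
  fix e and z :: "_ \<Rightarrow> real"
  assume "e \<in> I \<times> J"
  then obtain i j where e: "e = (i, j)" "i \<in> I" "j \<in> J" by auto
  obtain \<alpha> \<beta> where q: "\<And>t. q i ((\<lambda>j. z (i, j))(j := t)) = \<alpha> + \<beta> * t"
    using multiaffineD[OF assms(2)[OF e(2)] e(3)] by blast
  obtain \<gamma> \<delta> where p: "\<And>t. p ((\<lambda>i. q i (\<lambda>j. z (i, j)))(i := t)) = \<gamma> + \<delta> * t"
    using multiaffineD[OF assms(1) e(2)] by blast
  have "(\<lambda>j'. (z(e := t)) (i', j'))
      = (if i' = i then (\<lambda>j. z (i, j))(j := t) else (\<lambda>j'. z (i', j')))" for t i'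
    using e by (auto simp: fun_eq_iff)
  then have "(\<lambda>i'. q i' (\<lambda>j'. (z(e := t)) (i', j')))
      = (\<lambda>i. q i (\<lambda>j. z (i, j)))(i := \<alpha> + \<beta> * t)" for t
    by (auto simp: fun_eq_iff q)
  then have "p (\<lambda>i'. q i' (\<lambda>j'. (z(e := t)) (i', j'))) = (\<gamma> + \<delta> * \<alpha>) + (\<delta> * \<beta>) * t" for t
    by (simp add: p algebra_simps)
  then show "\<exists>\<alpha> \<beta>. \<forall>t. p (\<lambda>i'. q i' (\<lambda>j'. (z(e := t)) (i', j'))) = \<alpha> + \<beta> * t" by blast
qed

lemma multiaffine_row:
  assumes "multiaffine J p"
  shows "multiaffine (I \<times> J) (\<lambda>z. p (\<lambda>j. z (i, j)))"
proof (rule multiaffineI)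
  fix e and z :: "_ \<Rightarrow> real"
  assume "e \<in> I \<times> J"
  then obtain i' j where e: "e = (i', j)" "j \<in> J" by auto
  have "(\<lambda>j'. (z(e := t)) (i, j'))
      = (if i = i' then (\<lambda>j. z (i, j))(j := t) else (\<lambda>j'. z (i, j')))" for t
    using e by (auto simp: fun_eq_iff)
  moreover obtain \<alpha> \<beta> where "\<And>t. p ((\<lambda>j. z (i, j))(j := t)) = \<alpha> + \<beta> * t"
    using multiaffineD[OF assms e(2)] by blast
  ultimately have "p (\<lambda>j'. (z(e := t)) (i, j'))
      = (if i = i' then \<alpha> else p (\<lambda>j'. z (i, j'))) + (if i = i' then \<beta> else 0) * t" for t
    by (cases "i = i'") (simp_all del: fun_upd_apply)
  then show "\<exists>\<alpha> \<beta>. \<forall>t. p (\<lambda>j'. (z(e := t)) (i, j')) = \<alpha> + \<beta> * t" by blast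
qed

lemma multiaffine_transpose:
  assumes "multiaffine (J \<times> I) p"
  shows "multiaffine (I \<times> J) (\<lambda>z. p (\<lambda>(j, i). z (i, j)))"
proof (rule multiaffineI)
  fix e and z :: "_ \<Rightarrow> real"
  assume "e \<in> I \<times> J"
  then obtain i j where e: "e = (i, j)" "i \<in> I" "j \<in> J" by auto
  then have "(\<lambda>(j', i'). (z(e := t)) (i', j')) = (\<lambda>(j, i). z (i, j))((j, i) := t)" for t
    by (auto simp: fun_eq_iff)
  then show "\<exists>\<alpha> \<beta>. \<forall>t. p (\<lambda>(j', i'). (z(e := t)) (i', j')) = \<alpha> + \<beta> * t"
    using assms e unfolding multiaffine_def by simp
qed

lemma multiaffine_surj:
  assumes "multiaffine I p" "i \<in> I" "p (x(i := s)) \<noteq> p (x(i := s'))"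
  shows "\<exists>y. p y = c"
proof -
  obtain \<alpha> \<beta> where p: "\<And>t. p (x(i := t)) = \<alpha> + \<beta> * t"
    using multiaffineD[OF assms(1,2)] by blast
  then have "\<beta> \<noteq> 0" using assms(3) by auto
  then have "p (x(i := (c - \<alpha>) / \<beta>)) = c" by (simp add: p)
  then show ?thesis by blast
qed

section \<open>Multilinear extensions and their Taylor expansions\<close>

lemma multiaffine_mlext: "finite I \<Longrightarrow> multiaffine J (mlext I f)"
  unfolding mlext_def by (rule multiaffine_polynomial) (auto intro: finite_subset)

lemma depends_only_polynomial:
  assumes "\<And>S. S \<in> \<A> \<Longrightarrow> S \<subseteq> I"
  shows "depends_only I (\<lambda>x. \<Sum>S\<in>\<A>. c S * (\<Prod>i\<in>S. x i))"
  unfolding depends_only_def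
proof (intro allI impI sum.cong refl)
  fix x y :: "'a \<Rightarrow> real" and S assume "\<forall>i\<in>I. x i = y i" "S \<in> \<A>"
  then show "c S * (\<Prod>i\<in>S. x i) = c S * (\<Prod>i\<in>S. y i)"
    using assms by (intro arg_cong2[of _ _ _ _ "(*)"] prod.cong refl) blast
qed

lemma depends_only_mlext: "depends_only I (mlext I f)"
  unfolding mlext_def by (rule depends_only_polynomial) auto

lemma mlext_cong: "(\<And>i. i \<in> I \<Longrightarrow> x i = y i) \<Longrightarrow> mlext I f x = mlext I f y"
  by (rule depends_onlyD[OF depends_only_mlext])

text \<open>Both sides are affine in each coordinate, so \<open>multiaffine_eqI\<close> leaves only
  sign vectors; there \<open>depends_only\<close> permits restricting the point to \<open>I\<close>,
  which puts it into \<open>sign_cube I\<close>.\<close>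

lemma mlext_multiaffine:
  assumes "finite I" "multiaffine I p" "depends_only I p"
  shows "mlext I p x = p x"
proof (rule multiaffine_eqI[OF assms(1) multiaffine_mlext[OF assms(1)] assms(2)])
  fix x :: "'a \<Rightarrow> real" assume "\<And>i. i \<in> I \<Longrightarrow> x i = 1 \<or> x i = -1"
  then have "restrict x I \<in> sign_cube I"
    unfolding sign_cube_def by (auto simp: PiE_iff)
  then have "mlext I p (restrict x I) = p (restrict x I)"
    by (rule mlext_sign_cube[OF assms(1)])
  then show "mlext I p x = p x"
    using mlext_cong[of I x "restrict x I" p] depends_onlyD[OF assms(3), of x "restrict x I"]
    by simp
qed

lemma polynomial_coeff_unique:
  assumes "finite I"
    and "\<And>x. (\<Sum>S\<in>Pow I. c S * (\<Prod>i\<in>S. x i)) = (\<Sum>S\<in>Pow I. c' S * (\<Prod>i\<in>S. x i :: real))"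
    and "T \<subseteq> I"
  shows "c T = c' T"
proof -
  let ?f = "\<lambda>x. \<Sum>S\<in>Pow I. c S * (\<Prod>i\<in>S. x i :: real)"
  have "fourier_coeff I ?f T = c T" "fourier_coeff I ?f T = c' T"
    using assms by (auto intro!: fourier_coeff_unique)
  then show ?thesis by simp
qed

text \<open>If no supporting set contains \<open>i\<close>, the expansion does not involve
  \<open>x i\<close>. Conversely, if \<open>f\<close> ignores \<open>i\<close>, flipping that
  coordinate preserves \<open>f\<close> and negates the character of every \<open>S\<close>
  containing \<open>i\<close>, so the coefficient at \<open>S\<close> equals its own
  negative.\<close>

lemma Dep_iff_fourier_supp:
  assumes "finite I"
  shows "i \<in> Dep I f \<longleftrightarrow> (\<exists>S\<in>fourier_supp I f. i \<in> S)"
proof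
  assume i: "i \<in> Dep I f"
  show "\<exists>S\<in>fourier_supp I f. i \<in> S"
  proof (rule ccontr)
    assume "\<not> ?thesis"
    then have no: "fourier_coeff I f S = 0" if "S \<subseteq> I" "i \<in> S" for S
      using that unfolding fourier_supp_def by auto
    obtain x where x: "x \<in> sign_cube I" "f (x(i := 1)) \<noteq> f (x(i := -1))" "i \<in> I"
      using i unfolding Dep_def by auto
    have cube: "x(i := 1) \<in> sign_cube I" "x(i := -1) \<in> sign_cube I"
      using x(1,3) unfolding sign_cube_def by (auto simp: PiE_iff extensional_def)
    have "mlext I f (x(i := 1)) = mlext I f (x(i := -1))"
      unfolding mlext_def
    proof (intro sum.cong refl)
      fix S assume S: "S \<in> Pow I"
      show "fourier_coeff I f S * (\<Prod>k\<in>S. (x(i := 1)) k)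
          = fourier_coeff I f S * (\<Prod>k\<in>S. (x(i := -1)) k)"
      proof (cases "i \<in> S")
        case True
        then show ?thesis using no S by simp
      next
        case False
        then show ?thesis by (intro arg_cong2[of _ _ _ _ "(*)"] prod.cong refl) auto
      qed
    qed
    then show False using x(2) cube by (simp add: mlext_sign_cube[OF assms])
  qed
next
  assume "\<exists>S\<in>fourier_supp I f. i \<in> S"
  then obtain S where S: "S \<subseteq> I" "fourier_coeff I f S \<noteq> 0" "i \<in> S"
    unfolding fourier_supp_def by auto
  show "i \<in> Dep I f"
  proof (rule ccontr)
    assume "i \<notin> Dep I f"
    then have eq: "f (x(i := 1)) = f (x(i := -1))" if "x \<in> sign_cube I" for x
      using S that unfolding Dep_def by auto
    define \<sigma> where "\<sigma> x = x(i := - x i)" for x :: "'a \<Rightarrow> real"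
    have \<sigma>: "\<sigma> x \<in> sign_cube I" "\<sigma> (\<sigma> x) = x" if "x \<in> sign_cube I" for x
      using that S unfolding \<sigma>_def sign_cube_def by (auto simp: PiE_iff extensional_def)
    have f\<sigma>: "f (\<sigma> x) = f x" if "x \<in> sign_cube I" for x
    proof -
      have "x i = 1 \<or> x i = -1" using sign_cube_nth[OF that] S by auto
      then show ?thesis using eq[OF that] unfolding \<sigma>_def
        by (metis fun_upd_triv add.inverse_inverse)
    qed
    have fin: "finite S" using S assms finite_subset by blast
    have "(\<Prod>k\<in>S. \<sigma> x k) = - (\<Prod>k\<in>S. x k)" for x
    proof -
      have "(\<Prod>k\<in>S. \<sigma> x k) = \<sigma> x i * (\<Prod>k\<in>S - {i}. \<sigma> x k)"
        using S fin by (subst prod.remove[of _ i]) auto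
      also have "\<dots> = - x i * (\<Prod>k\<in>S - {i}. x k)"
        by (intro arg_cong2[of _ _ _ _ "(*)"] prod.cong refl) (auto simp: \<sigma>_def)
      also have "\<dots> = - (\<Prod>k\<in>S. x k)"
        using S fin by (subst prod.remove[of S i]) auto
      finally show ?thesis .
    qed
    then have "(\<Sum>x\<in>sign_cube I. f x * (\<Prod>k\<in>S. x k))
        = (\<Sum>x\<in>sign_cube I. - (f x * (\<Prod>k\<in>S. x k)))"
      by (intro sum.reindex_bij_witness[of _ \<sigma> \<sigma>]) (auto simp: \<sigma> f\<sigma>)
    then show False using S(2) unfolding fourier_coeff_def by (simp add: sum_negf)
  qed
qed

section \<open>Taylor expansion of a multilinear extension around an arbitrary point\<close>

definition taylor_coeff ::
    "'i set \<Rightarrow> (('i \<Rightarrow> real) \<Rightarrow> real) \<Rightarrow> ('i \<Rightarrow> real) \<Rightarrow> 'i set \<Rightarrow> real" where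
  "taylor_coeff I f x S = (\<Sum>R\<in>Pow (I - S). fourier_coeff I f (S \<union> R) * (\<Prod>i\<in>R. x i))"

text \<open>Write \<open>x i = (x i - y i) + y i\<close>, expand every monomial \<open>Q\<close>,
  and regroup the pairs \<open>S \<subseteq> Q\<close> by \<open>S\<close> and
  \<open>R = Q - S\<close>. Thus \<open>taylor_coeff I f y S\<close> is the mixed partial derivative
  at \<open>y\<close> along the coordinates of \<open>S\<close>.\<close>

lemma mlext_taylor:
  assumes "finite I"
  shows "mlext I f x = (\<Sum>S\<in>Pow I. taylor_coeff I f y S * (\<Prod>i\<in>S. x i - y i))"
proof -
  have "mlext I f x = (\<Sum>Q\<in>Pow I. \<Sum>S\<in>Pow Q.
      fourier_coeff I f Q * ((\<Prod>i\<in>S. x i - y i) * (\<Prod>i\<in>Q - S. y i)))"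
    unfolding mlext_def
  proof (intro sum.cong refl)
    fix Q assume "Q \<in> Pow I"
    then have "finite Q" using assms finite_subset by blast
    then have "(\<Prod>i\<in>Q. (x i - y i) + y i)
        = (\<Sum>S\<in>Pow Q. (\<Prod>i\<in>S. x i - y i) * (\<Prod>i\<in>Q - S. y i))"
      by (rule prod_add)
    then show "fourier_coeff I f Q * (\<Prod>i\<in>Q. x i) = (\<Sum>S\<in>Pow Q.
        fourier_coeff I f Q * ((\<Prod>i\<in>S. x i - y i) * (\<Prod>i\<in>Q - S. y i)))"
      by (simp add: sum_distrib_left)
  qed
  also have "\<dots> = (\<Sum>(Q, S)\<in>Sigma (Pow I) Pow.
      fourier_coeff I f Q * ((\<Prod>i\<in>S. x i - y i) * (\<Prod>i\<in>Q - S. y i)))"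
    using assms by (subst sum.Sigma) (auto intro: finite_subset)
  also have "\<dots> = (\<Sum>(S, R)\<in>Sigma (Pow I) (\<lambda>S. Pow (I - S)).
      fourier_coeff I f (S \<union> R) * (\<Prod>i\<in>R. y i) * (\<Prod>i\<in>S. x i - y i))"
    by (rule sum.reindex_bij_witness[of _ "\<lambda>(S, R). (S \<union> R, S)" "\<lambda>(Q, S). (S, Q - S)"])
       (auto simp: Un_absorb1 Un_Diff_cancel Un_Diff Diff_triv Int_commute mult_ac
         intro!: arg_cong[of _ _ "fourier_coeff I f"])
  also have "\<dots> = (\<Sum>S\<in>Pow I. taylor_coeff I f y S * (\<Prod>i\<in>S. x i - y i))"
    using assms by (subst sum.Sigma[symmetric]) (auto simp: taylor_coeff_def sum_distrib_right)
  finally show ?thesis .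
qed

text \<open>At \<open>x = y\<close> all terms with nonempty \<open>S\<close> vanish, so the constant
  term is the value at \<open>y\<close>. This increment of an inner function is what gets
  substituted into the outer expansion.\<close>

lemma mlext_taylor_nonconst:
  assumes "finite I"
  shows "mlext I f x - mlext I f y
    = (\<Sum>S\<in>Pow I - {{}}. taylor_coeff I f y S * (\<Prod>i\<in>S. x i - y i))"
proof -
  have split: "mlext I f x = taylor_coeff I f y {}
      + (\<Sum>S\<in>Pow I - {{}}. taylor_coeff I f y S * (\<Prod>i\<in>S. x i - y i))" for x
    unfolding mlext_taylor[OF assms, of f x y]
    using assms by (subst sum.remove[of _ "{}"]) auto
  have "(\<Sum>S\<in>Pow I - {{}}. taylor_coeff I f y S * (\<Prod>i\<in>S. y i - y i)) = 0"
    using assms by (intro sum.neutral ballI) (auto dest: finite_subset)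
  then show ?thesis using split[of x] split[of y] by simp
qed

lemma multiaffine_taylor_coeff:
  "finite I \<Longrightarrow> multiaffine J (\<lambda>x. taylor_coeff I f x S)"
  unfolding taylor_coeff_def by (rule multiaffine_polynomial) (auto intro: finite_subset)

lemma depends_only_taylor_coeff: "depends_only I (\<lambda>x. taylor_coeff I f x S)"
  unfolding taylor_coeff_def by (rule depends_only_polynomial) auto

text \<open>The simplicial complex generated by the Fourier support. Among subsets of
  \<open>I\<close>, it consists of those whose Taylor coefficient is not identically zero in the
  base point.\<close>

definition below_supp :: "'i set \<Rightarrow> (('i \<Rightarrow> real) \<Rightarrow> real) \<Rightarrow> 'i set \<Rightarrow> bool" where
  "below_supp I f S \<longleftrightarrow> (\<exists>Q\<in>fourier_supp I f. S \<subseteq> Q)"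

lemma below_supp_subset: "below_supp I f S \<Longrightarrow> S \<subseteq> I"
  unfolding below_supp_def fourier_supp_def by auto

lemma below_supp_mono: "below_supp I f S \<Longrightarrow> T \<subseteq> S \<Longrightarrow> below_supp I f T"
  unfolding below_supp_def by auto

lemma below_supp_singleton: "finite I \<Longrightarrow> below_supp I f {i} \<longleftrightarrow> i \<in> Dep I f"
  unfolding below_supp_def by (simp add: Dep_iff_fourier_supp)

lemma taylor_coeff_eq_0: "S \<subseteq> I \<Longrightarrow> \<not> below_supp I f S \<Longrightarrow> taylor_coeff I f x S = 0"
  unfolding taylor_coeff_def below_supp_def fourier_supp_def
  by (intro sum.neutral ballI) (simp, metis Diff_subset Un_least Un_upper1 subset_trans)

text \<open>As a polynomial in the base point, the coefficient at \<open>S\<close> has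
  \<open>fourier_coeff I f Q\<close> as its own coefficient at \<open>Q - S\<close>; uniqueness of
  coefficients prevents it from vanishing everywhere.\<close>

lemma taylor_coeff_nonzero:
  assumes "finite I" "below_supp I f S"
  shows "\<exists>x. taylor_coeff I f x S \<noteq> 0"
proof (rule ccontr)
  assume "\<not> ?thesis"
  then have zero: "taylor_coeff I f x S = 0" for x by blast
  obtain Q where Q: "Q \<subseteq> I" "fourier_coeff I f Q \<noteq> 0" "S \<subseteq> Q"
    using assms(2) unfolding below_supp_def fourier_supp_def by auto
  have "fourier_coeff I f (S \<union> (Q - S)) = (\<lambda>_. 0) (Q - S)"
  proof (rule polynomial_coeff_unique[of "I - S" "\<lambda>R. fourier_coeff I f (S \<union> R)"])
    show "(\<Sum>R\<in>Pow (I - S). fourier_coeff I f (S \<union> R) * (\<Prod>i\<in>R. x i))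
        = (\<Sum>R\<in>Pow (I - S). 0 * (\<Prod>i\<in>R. x i))" for x
      using zero[of x] unfolding taylor_coeff_def by simp
  qed (use assms Q in auto)
  then show False using Q by (simp add: Un_absorb1)
qed

lemma prod_over_rows:
  assumes "finite W"
  shows "(\<Prod>i\<in>fst ` W. \<Prod>j\<in>W `` {i}. F i j) = (\<Prod>(i, j)\<in>W. F i j)"
proof -
  have "W = Sigma (fst ` W) (\<lambda>i. W `` {i})" by force
  moreover have "finite (W `` {i})" for i using assms by (rule finite_Image)
  ultimately show ?thesis using assms prod.Sigma[of "fst ` W" "\<lambda>i. W `` {i}" F] by auto
qed

lemma prod_over_cols:
  assumes "finite W"
  shows "(\<Prod>j\<in>snd ` W. \<Prod>i\<in>W\<inverse> `` {j}. F i j) = (\<Prod>(i, j)\<in>W. F i j)"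
proof -
  have "snd ` W = fst ` W\<inverse>" by force
  then have "(\<Prod>j\<in>snd ` W. \<Prod>i\<in>W\<inverse> `` {j}. F i j) = (\<Prod>(j, i)\<in>W\<inverse>. F i j)"
    using prod_over_rows[of "W\<inverse>" "\<lambda>j i. F i j"] assms by simp
  also have "\<dots> = (\<Prod>(i, j)\<in>W. F i j)"
    by (rule prod.reindex_bij_witness[of _ prod.swap prod.swap]) auto
  finally show ?thesis .
qed

section \<open>Two factorisations of the same multilinear polynomial\<close>

text \<open>The coefficients \<open>a\<close>, \<open>b i\<close>, \<open>c\<close>, \<open>d j\<close> are those of \<open>f\<^sub>0\<close>, \<open>g\<^sub>i\<close>, \<open>g\<^sub>0\<close>, \<open>f\<^sub>j\<close> around a
  generic point; \<open>coeff_eq\<close> compares the coefficients of \<open>\<Prod>(i,j)\<in>W. z\<^sub>i\<^sub>j\<close> on both sides.\<close>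

locale coefficient_system =
  fixes I :: "'i set" and J :: "'j set"
    and a :: "'i set \<Rightarrow> real" and b :: "'i \<Rightarrow> 'j set \<Rightarrow> real"
    and c :: "'j set \<Rightarrow> real" and d :: "'j \<Rightarrow> 'i set \<Rightarrow> real"
  assumes finite_I: "finite I" and finite_J: "finite J"
    and coeff_eq: "\<And>W. W \<subseteq> I \<times> J \<Longrightarrow>
      a (fst ` W) * (\<Prod>i\<in>fst ` W. b i (W `` {i})) = c (snd ` W) * (\<Prod>j\<in>snd ` W. d j (W\<inverse> `` {j}))"
    and a_single: "\<And>i. i \<in> I \<Longrightarrow> a {i} \<noteq> 0" and c_single: "\<And>j. j \<in> J \<Longrightarrow> c {j} \<noteq> 0"
    and b_down: "\<And>i T T'. i \<in> I \<Longrightarrow> T \<subseteq> J \<Longrightarrow> T' \<subseteq> T \<Longrightarrow> b i T \<noteq> 0 \<Longrightarrow> b i T' \<noteq> 0"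
    and d_down: "\<And>j S S'. j \<in> J \<Longrightarrow> S \<subseteq> I \<Longrightarrow> S' \<subseteq> S \<Longrightarrow> d j S \<noteq> 0 \<Longrightarrow> d j S' \<noteq> 0"
    and b_pair: "\<And>i j. i \<in> I \<Longrightarrow> j \<in> J \<Longrightarrow> b i {j} \<noteq> 0 \<Longrightarrow> \<exists>j'\<in>J. j' \<noteq> j \<and> b i {j, j'} \<noteq> 0"
    and d_pair: "\<And>i j. i \<in> I \<Longrightarrow> j \<in> J \<Longrightarrow> d j {i} \<noteq> 0 \<Longrightarrow> \<exists>i'\<in>I. i' \<noteq> i \<and> d j {i, i'} \<noteq> 0"
    and b_ex: "\<And>i. i \<in> I \<Longrightarrow> \<exists>j\<in>J. b i {j} \<noteq> 0"
    and d_ex: "\<And>j. j \<in> J \<Longrightarrow> \<exists>i\<in>I. d j {i} \<noteq> 0"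
begin

text \<open>The assumptions are symmetric in rows and columns, so each later result about rows also
  yields its column version.\<close>

lemma transpose: "coefficient_system J I c d a b"
proof
  fix W :: "('j \<times> 'i) set" assume "W \<subseteq> J \<times> I"
  then have "W\<inverse> \<subseteq> I \<times> J" by auto
  from coeff_eq[OF this]
  show "c (fst ` W) * (\<Prod>j\<in>fst ` W. d j (W `` {j})) = a (snd ` W) * (\<Prod>i\<in>snd ` W. b i (W\<inverse> `` {i}))"
    by (simp add: converse_unfold image_def Bex_def)
qed (rule finite_I finite_J |
    (rule a_single c_single b_ex d_ex b_pair d_pair b_down d_down; assumption))+

text \<open>Take \<open>W\<close> to be part of a single row: each column of \<open>W\<close> is
  then the singleton \<open>{i}\<close>.\<close>

lemma coeff_row:
  assumes "i \<in> I" "T \<subseteq> J" "T \<noteq> {}"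
  shows "a {i} * b i T = c T * (\<Prod>j\<in>T. d j {i})"
proof -
  let ?W = "{i} \<times> T"
  have "fst ` ?W = {i}" "snd ` ?W = T" "?W `` {i} = T"
    and "\<And>j. j \<in> T \<Longrightarrow> ?W\<inverse> `` {j} = {i}"
    using assms by auto
  moreover have "?W \<subseteq> I \<times> J" using assms by auto
  ultimately show ?thesis using coeff_eq[of ?W] by simp
qed

lemma coeff_edge: "i \<in> I \<Longrightarrow> j \<in> J \<Longrightarrow> a {i} * b i {j} = c {j} * d j {i}"
  using coeff_row[of i "{j}"] by simp

lemma edge_iff: "i \<in> I \<Longrightarrow> j \<in> J \<Longrightarrow> b i {j} \<noteq> 0 \<longleftrightarrow> d j {i} \<noteq> 0"
  using coeff_edge[of i j] a_single[of i] c_single[of j] by auto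

section \<open>The bipartite graph of nonzero singleton coefficients\<close>

definition nbr_row :: "'i \<Rightarrow> 'j set" where
  "nbr_row i = {j \<in> J. b i {j} \<noteq> 0}"

definition nbr_col :: "'j \<Rightarrow> 'i set" where
  "nbr_col j = {i \<in> I. d j {i} \<noteq> 0}"

lemma nbr_transpose:
  "coefficient_system.nbr_row I d = nbr_col" "coefficient_system.nbr_col J b = nbr_row"
  using coefficient_system.nbr_row_def[OF transpose] coefficient_system.nbr_col_def[OF transpose]
  by (auto simp: fun_eq_iff nbr_row_def nbr_col_def)

lemma nbr_iff: "i \<in> I \<Longrightarrow> j \<in> J \<Longrightarrow> j \<in> nbr_row i \<longleftrightarrow> i \<in> nbr_col j"
  unfolding nbr_row_def nbr_col_def using edge_iff by auto

lemma nbr_row_sub: "nbr_row i \<subseteq> J" and nbr_col_sub: "nbr_col j \<subseteq> I"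
  unfolding nbr_row_def nbr_col_def by auto

lemma row_other:
  assumes "i \<in> I" "j \<in> nbr_row i"
  obtains j' where "j' \<in> nbr_row i" "j' \<noteq> j" "b i {j, j'} \<noteq> 0"
proof -
  obtain j' where "j' \<in> J" "j' \<noteq> j" "b i {j, j'} \<noteq> 0"
    using b_pair assms unfolding nbr_row_def by auto
  moreover from this have "b i {j'} \<noteq> 0"
    using b_down[of i "{j, j'}" "{j'}"] assms unfolding nbr_row_def by auto
  ultimately show thesis using that unfolding nbr_row_def by auto
qed

lemma col_other:
  assumes "j \<in> J" "i \<in> nbr_col j"
  obtains i' where "i' \<in> nbr_col j" "i' \<noteq> i" "d j {i, i'} \<noteq> 0"
  using coefficient_system.row_other[OF transpose, unfolded nbr_transpose] assms by blast

text \<open>Here \<open>W\<close> is \<open>{i} \<times> T\<close> together with one point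
  \<open>(i', j)\<close> in a new row and a new column, so all columns of \<open>W\<close> are
  singletons while two rows occur.\<close>

lemma coeff_hook:
  assumes "i \<in> I" "i' \<in> I" "i \<noteq> i'" "j \<in> J" "T \<subseteq> J" "T \<noteq> {}" "j \<notin> T"
  shows "a {i, i'} * b i T * b i' {j} = c (insert j T) * (\<Prod>k\<in>T. d k {i}) * d j {i'}"
proof -
  let ?W = "insert (i', j) ({i} \<times> T)"
  have sub: "?W \<subseteq> I \<times> J" using assms by auto
  have fin: "finite T" using assms(5) finite_J by (rule finite_subset)
  have 1: "fst ` ?W = {i, i'}" "snd ` ?W = insert j T" using assms by auto
  have 2: "?W `` {i} = T" "?W `` {i'} = {j}" "?W\<inverse> `` {j} = {i'}" using assms by auto
  have "(\<Prod>k\<in>T. d k (?W\<inverse> `` {k})) = (\<Prod>k\<in>T. d k {i})"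
    using assms by (intro prod.cong refl arg_cong[of _ _ "d _"]) auto
  then show ?thesis
    using coeff_eq[OF sub] assms fin unfolding 1 by (simp add: 2 mult_ac)
qed

text \<open>In the transposed single-row identity for column \<open>j\<close> and
  \<open>{i, i'}\<close>, the side \<open>c {j} * d j {i, i'}\<close> is nonzero, hence so is the
  factor \<open>a {i, i'}\<close>.\<close>

lemma col_pair_nonzero:
  assumes "j \<in> J" "i \<in> I" "i' \<in> I" "i \<noteq> i'" "d j {i, i'} \<noteq> 0"
  shows "a {i, i'} \<noteq> 0"
  using coefficient_system.coeff_row[OF transpose, of j "{i, i'}"] assms c_single[of j] by auto

text \<open>With \<open>nonzero_in_nbr_row\<close> this makes the complex of \<open>b i\<close> a
  full simplex on \<open>nbr_row i\<close>. To add \<open>j\<close> to \<open>T\<close>, choose a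
  partner \<open>i'\<close> of \<open>i\<close> in column \<open>j\<close>: the hook on
  \<open>T\<close> and \<open>(i', j)\<close> gives \<open>c (insert j T) \<noteq> 0\<close>, and
  the single-row identity turns this into \<open>b i (insert j T) \<noteq> 0\<close>.\<close>

lemma row_coeff_nonzero:
  assumes "i \<in> I" "T \<subseteq> nbr_row i" "T \<noteq> {}"
  shows "b i T \<noteq> 0"
proof -
  have "finite T" using assms(2) nbr_row_sub finite_J by (meson finite_subset)
  then show ?thesis using assms(3,2)
  proof (induction T rule: finite_ne_induct)
    case (singleton j)
    then show ?case unfolding nbr_row_def by auto
  next
    case (insert j T)
    then have j: "j \<in> J" "j \<in> nbr_row i" and T: "T \<subseteq> J" and bT: "b i T \<noteq> 0"
      using nbr_row_sub by auto
    obtain i' where i': "i' \<in> nbr_col j" "i' \<noteq> i" "d j {i, i'} \<noteq> 0"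
      using col_other[of j i] j nbr_iff assms(1) by blast
    have i'I: "i' \<in> I" using i' nbr_col_sub by blast
    have "a {i, i'} \<noteq> 0" using col_pair_nonzero j i' i'I assms(1) by blast
    moreover have "b i' {j} \<noteq> 0" using i' i'I j edge_iff unfolding nbr_col_def by auto
    ultimately have "c (insert j T) \<noteq> 0"
      using coeff_hook[of i i' j T] assms(1) i'I i' j T insert.hyps bT by auto
    moreover have "d k {i} \<noteq> 0" if "k \<in> insert j T" for k
      using that insert.prems edge_iff[OF assms(1)] unfolding nbr_row_def by auto
    ultimately have "c (insert j T) * (\<Prod>k\<in>insert j T. d k {i}) \<noteq> 0"
      using insert.hyps(1) by simp
    then show ?case using coeff_row[of i "insert j T"] assms(1) j T by auto
  qed
qed

lemma nonzero_in_nbr_row: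
  assumes "i \<in> I" "T \<subseteq> J" "b i T \<noteq> 0"
  shows "T \<subseteq> nbr_row i"
proof
  fix j assume "j \<in> T"
  then show "j \<in> nbr_row i"
    using b_down[of i T "{j}"] assms unfolding nbr_row_def by auto
qed

section \<open>Outer coefficients normalised at singletons, and their ratios\<close>

definition norm_a :: "'i set \<Rightarrow> real" where
  "norm_a S = a S / (\<Prod>i\<in>S. a {i})"

definition norm_c :: "'j set \<Rightarrow> real" where
  "norm_c T = c T / (\<Prod>j\<in>T. c {j})"

lemma norm_transpose:
  "coefficient_system.norm_a c = norm_c" "coefficient_system.norm_c a = norm_a"
  using coefficient_system.norm_a_def[OF transpose] coefficient_system.norm_c_def[OF transpose]
  by (auto simp: fun_eq_iff norm_a_def norm_c_def)

lemma norm_a_pair_nonzero: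
  assumes "j \<in> J" "i \<in> nbr_col j" "i' \<in> nbr_col j" "i \<noteq> i'"
  shows "norm_a {i, i'} \<noteq> 0"
proof -
  have "d j {i, i'} \<noteq> 0"
    using coefficient_system.row_coeff_nonzero[OF transpose, unfolded nbr_transpose, of j "{i, i'}"]
      assms by auto
  then show ?thesis
    using col_pair_nonzero[of j i i'] assms nbr_col_sub[of j] a_single unfolding norm_a_def by auto
qed

text \<open>The single-row and edge identities eliminate all coefficients of inner functions from
  the hook identity. What remains says that a new column multiplies \<open>norm_c\<close> by a
  factor that does not involve \<open>T\<close>.\<close>

lemma norm_c_insert:
  assumes "i \<in> I" "j \<in> nbr_row i" "i' \<in> nbr_col j" "i' \<noteq> i" "T \<subseteq> nbr_row i" "T \<noteq> {}" "j \<notin> T"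
  shows "norm_c (insert j T) = norm_a {i, i'} * norm_c T"
proof -
  have j: "j \<in> J" and T: "T \<subseteq> J" and i': "i' \<in> I"
    using assms(2,3,5) nbr_row_sub[of i] nbr_col_sub[of j] by (blast, blast, blast)
  have fin: "finite T" using T finite_J by (rule finite_subset)
  have nz: "a {i} \<noteq> 0" "a {i'} \<noteq> 0" "c {j} \<noteq> 0" "d j {i'} \<noteq> 0"
    using assms(1,3) i' j a_single c_single unfolding nbr_col_def by simp_all
  have D: "(\<Prod>k\<in>T. d k {i}) \<noteq> 0" (is "?D \<noteq> 0")
    using fin assms(5) edge_iff[OF assms(1)] unfolding nbr_row_def prod_zero_iff[OF fin] by blast
  have cT: "(\<Prod>k\<in>T. c {k}) \<noteq> 0"
    unfolding prod_zero_iff[OF fin] using T c_single by blast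
  have "a {i, i'} * (c T * ?D) * (c {j} * d j {i'}) = a {i, i'} * (a {i} * b i T) * (a {i'} * b i' {j})"
    using coeff_row[OF assms(1) T assms(6)] coeff_edge[OF i' j] by simp
  also have "\<dots> = a {i} * a {i'} * (c (insert j T) * ?D * d j {i'})"
    using coeff_hook[OF assms(1) i' assms(4)[symmetric] j T assms(6,7)] by (simp add: mult_ac)
  finally have "a {i, i'} * c T * c {j} = a {i} * a {i'} * c (insert j T)"
    using D nz by (simp add: field_simps)
  then show ?thesis
    using nz cT fin assms(4,7) unfolding norm_a_def norm_c_def by (simp add: field_simps)
qed

text \<open>The key symmetry: the left side does not mention \<open>i'\<close> and the right side
  does not mention \<open>j'\<close>, so both are constant as these vary.\<close>

lemma norm_c_pair:
  assumes "i \<in> I" "j \<in> nbr_row i" "i' \<in> nbr_col j" "i' \<noteq> i" "j' \<in> nbr_row i" "j' \<noteq> j"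
  shows "norm_c {j, j'} = norm_a {i, i'}"
proof -
  have "norm_c {j'} = 1" using assms nbr_row_sub c_single unfolding norm_c_def by auto
  then show ?thesis using norm_c_insert[OF assms(1-4), of "{j'}"] assms by simp
qed

text \<open>Two pairs \<open>(j, i')\<close> and \<open>(k, k')\<close> are compared through
  \<open>norm_c\<close>: if \<open>j \<noteq> k\<close>, both values equal
  \<open>norm_c {j, k}\<close>; if \<open>j = k\<close>, both equal \<open>norm_c {j, j'}\<close>
  for another neighbour \<open>j'\<close> of \<open>i\<close>. At least one such pair exists, and
  its value is nonzero.\<close>

lemma row_ratio:
  assumes "i \<in> I"
  shows "\<exists>r. r \<noteq> 0 \<and> (\<forall>j\<in>nbr_row i. \<forall>i'\<in>nbr_col j. i' \<noteq> i \<longrightarrow> norm_a {i, i'} = r)"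
proof -
  have "norm_a {i, i'} = norm_a {i, k'}"
    if j: "j \<in> nbr_row i" "i' \<in> nbr_col j" "i' \<noteq> i" and k: "k \<in> nbr_row i" "k' \<in> nbr_col k" "k' \<noteq> i"
    for j i' k k'
  proof (cases "j = k")
    case True
    obtain j' where "j' \<in> nbr_row i" "j' \<noteq> j" using row_other assms j by blast
    then show ?thesis using norm_c_pair[OF assms j, of j'] norm_c_pair[OF assms k, of j'] True by simp
  next
    case False
    then show ?thesis
      using norm_c_pair[OF assms j, of k] norm_c_pair[OF assms k, of j] j k by (simp add: insert_commute)
  qed
  moreover obtain j where j: "j \<in> nbr_row i" using b_ex[OF assms] unfolding nbr_row_def by auto
  moreover from j have jJ: "j \<in> J" and i: "i \<in> nbr_col j" using nbr_row_sub nbr_iff assms by blast+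
  moreover obtain i' where "i' \<in> nbr_col j" "i' \<noteq> i" using col_other[OF jJ i] by blast
  moreover from this have "norm_a {i, i'} \<noteq> 0" using norm_a_pair_nonzero[OF jJ i] by auto
  ultimately show ?thesis by (intro exI[of _ "norm_a {i, i'}"]) blast
qed

text \<open>Every column after the first multiplies \<open>norm_c\<close> by \<open>r\<close>.
  Inserting this into the single-row identity makes \<open>b i\<close> multiplicative up to one
  constant per row.\<close>

lemma row_product:
  assumes i: "i \<in> I" and T: "T \<subseteq> nbr_row i" "T \<noteq> {}"
    and r: "\<And>j i'. j \<in> nbr_row i \<Longrightarrow> i' \<in> nbr_col j \<Longrightarrow> i' \<noteq> i \<Longrightarrow> norm_a {i, i'} = r"
  shows "a {i} * r * b i T = (\<Prod>j\<in>T. a {i} * b i {j} * r)"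
proof -
  have TJ: "T \<subseteq> J" using T nbr_row_sub by blast
  then have fin: "finite T" using finite_J by (rule finite_subset)
  \<comment> \<open>Singletons have \<open>norm_c\<close> equal to 1, so \<open>norm_c T\<close> is
    \<open>r\<close> to the power \<open>card T - 1\<close>; the extra factor \<open>r\<close>
    avoids the subtraction.\<close>
  from fin T(2,1) have pow: "r * norm_c T = r ^ card T"
  proof (induction T rule: finite_ne_induct)
    case (singleton j)
    then show ?case using nbr_row_sub c_single unfolding norm_c_def by auto
  next
    case (insert j T)
    then have j: "j \<in> nbr_row i" "j \<in> J" "i \<in> nbr_col j"
      using nbr_row_sub nbr_iff i by blast+
    obtain i' where i': "i' \<in> nbr_col j" "i' \<noteq> i" using col_other[OF j(2,3)] by blast
    have "norm_c (insert j T) = r * norm_c T"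
      using norm_c_insert[OF i j(1) i', of T] r[OF j(1) i'] insert by simp
    then show ?case using insert by simp
  qed
  have "a {i} * b i T = c T * (\<Prod>j\<in>T. a {i} * b i {j} / c {j})"
    unfolding coeff_row[OF i TJ T(2)]
    using TJ coeff_edge[OF i] c_single
    by (intro arg_cong2[of _ _ _ _ "(*)"] prod.cong refl) auto
  also have "\<dots> = norm_c T * (\<Prod>j\<in>T. a {i} * b i {j})"
    by (simp add: norm_c_def prod_dividef)
  finally have "a {i} * r * b i T = (r * norm_c T) * (\<Prod>j\<in>T. a {i} * b i {j})"
    by (simp add: mult_ac)
  also have "\<dots> = (\<Prod>j\<in>T. a {i} * b i {j} * r)"
    unfolding pow by (simp add: prod.distrib mult.commute)
  finally show ?thesis .
qed

text \<open>Grouped by rows or by columns, the inner coefficients contribute the same product of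
  \<open>k\<close> over \<open>W\<close>, which is nonzero and cancels from
  \<open>coeff_eq\<close>.\<close>

lemma balance:
  assumes W: "W \<subseteq> Sigma I nbr_row"
    and u: "\<And>i. i \<in> I \<Longrightarrow> u i \<noteq> 0" and v: "\<And>j. j \<in> J \<Longrightarrow> v j \<noteq> 0"
    and k: "\<And>i j. i \<in> I \<Longrightarrow> j \<in> nbr_row i \<Longrightarrow> k i j \<noteq> 0"
    and b: "\<And>i T. i \<in> I \<Longrightarrow> T \<subseteq> nbr_row i \<Longrightarrow> T \<noteq> {} \<Longrightarrow> u i * b i T = (\<Prod>j\<in>T. k i j)"
    and d: "\<And>j S. j \<in> J \<Longrightarrow> S \<subseteq> nbr_col j \<Longrightarrow> S \<noteq> {} \<Longrightarrow> v j * d j S = (\<Prod>i\<in>S. k i j)"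
  shows "a (fst ` W) / (\<Prod>i\<in>fst ` W. u i) = c (snd ` W) / (\<Prod>j\<in>snd ` W. v j)"
proof -
  have WIJ: "W \<subseteq> I \<times> J" using W nbr_row_sub by fast
  have fin: "finite W" using WIJ finite_I finite_J by (meson finite_SigmaI finite_subset)
  let ?K = "\<Prod>(i, j)\<in>W. k i j" and ?U = "\<Prod>i\<in>fst ` W. u i" and ?V = "\<Prod>j\<in>snd ` W. v j"
  have "?K = (\<Prod>i\<in>fst ` W. u i * b i (W `` {i}))"
    unfolding prod_over_rows[OF fin, of k, symmetric]
    using W by (intro prod.cong refl b[symmetric]) auto
  then have K1: "?K = ?U * (\<Prod>i\<in>fst ` W. b i (W `` {i}))" by (simp add: prod.distrib)
  have cols: "i \<in> nbr_col j" if "(i, j) \<in> W" for i j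
    using W WIJ that nbr_iff by blast
  have "?K = (\<Prod>j\<in>snd ` W. v j * d j (W\<inverse> `` {j}))"
    unfolding prod_over_cols[OF fin, of k, symmetric]
    using WIJ cols by (intro prod.cong refl d[symmetric]) auto
  then have K2: "?K = ?V * (\<Prod>j\<in>snd ` W. d j (W\<inverse> `` {j}))" by (simp add: prod.distrib)
  have "\<forall>e\<in>W. (case e of (i, j) \<Rightarrow> k i j) \<noteq> 0" using W k by auto
  then have K0: "?K \<noteq> 0" using fin by simp
  have "a (fst ` W) * ?K * ?V = (a (fst ` W) * (\<Prod>i\<in>fst ` W. b i (W `` {i}))) * (?U * ?V)"
    unfolding K1 by (simp only: mult_ac)
  also have "\<dots> = c (snd ` W) * ?K * ?U"
    unfolding coeff_eq[OF WIJ] K2 by (simp only: mult_ac)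
  finally have "a (fst ` W) * ?K * ?V = c (snd ` W) * ?K * ?U" .
  moreover have "?U \<noteq> 0" "?V \<noteq> 0" using fin WIJ u v by auto
  ultimately show ?thesis using K0 by (simp add: field_simps)
qed

text \<open>The witnesses are \<open>u i = a {i} * \<rho> i\<close>,
  \<open>v j = c {j} * \<sigma> j\<close> and \<open>k i j = a {i} * b i {j} * \<rho> i\<close>,
  with the row ratios \<open>\<rho>\<close> and column ratios \<open>\<sigma>\<close>. A single
  \<open>k\<close> serves rows and columns because of \<open>coeff_edge\<close> and because the two
  ratios agree along every edge.\<close>

theorem product_structure:
  obtains u v k where
    "\<And>i. i \<in> I \<Longrightarrow> u i \<noteq> 0" "\<And>j. j \<in> J \<Longrightarrow> v j \<noteq> 0"
    "\<And>i j. i \<in> I \<Longrightarrow> j \<in> nbr_row i \<Longrightarrow> k i j \<noteq> 0"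
    "\<And>i T. i \<in> I \<Longrightarrow> T \<subseteq> nbr_row i \<Longrightarrow> T \<noteq> {} \<Longrightarrow> u i * b i T = (\<Prod>j\<in>T. k i j)"
    "\<And>j S. j \<in> J \<Longrightarrow> S \<subseteq> nbr_col j \<Longrightarrow> S \<noteq> {} \<Longrightarrow> v j * d j S = (\<Prod>i\<in>S. k i j)"
    "\<And>W. W \<subseteq> Sigma I nbr_row \<Longrightarrow>
      a (fst ` W) / (\<Prod>i\<in>fst ` W. u i) = c (snd ` W) / (\<Prod>j\<in>snd ` W. v j)"
proof -
  obtain \<rho> where \<rho>: "\<And>i. i \<in> I \<Longrightarrow> \<rho> i \<noteq> (0::real)"
    "\<And>i j i'. i \<in> I \<Longrightarrow> j \<in> nbr_row i \<Longrightarrow> i' \<in> nbr_col j \<Longrightarrow> i' \<noteq> i \<Longrightarrow> norm_a {i, i'} = \<rho> i"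
    using row_ratio by metis
  obtain \<sigma> where \<sigma>: "\<And>j. j \<in> J \<Longrightarrow> \<sigma> j \<noteq> (0::real)"
    "\<And>i j j'. j \<in> J \<Longrightarrow> i \<in> nbr_col j \<Longrightarrow> j' \<in> nbr_row i \<Longrightarrow> j' \<noteq> j \<Longrightarrow> norm_c {j, j'} = \<sigma> j"
    using coefficient_system.row_ratio[OF transpose, unfolded nbr_transpose norm_transpose] by metis
  \<comment> \<open>The pair symmetry identifies the two ratios at the ends of an edge; they are
    therefore constant on connected components.\<close>
  have \<rho>\<sigma>: "\<rho> i = \<sigma> j" if ij: "i \<in> I" "j \<in> nbr_row i" for i j
  proof -
    have j: "j \<in> J" and i: "i \<in> nbr_col j" using ij nbr_row_sub nbr_iff by blast+
    obtain j' where j': "j' \<in> nbr_row i" "j' \<noteq> j" using row_other ij by blast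
    obtain i' where i': "i' \<in> nbr_col j" "i' \<noteq> i" using col_other j i by blast
    show ?thesis
      using norm_c_pair[OF ij i' j'] \<rho>(2)[OF ij i'] \<sigma>(2)[OF j i j'] by simp
  qed
  define e where "e i j = a {i} * b i {j}" for i j
  have bT: "a {i} * \<rho> i * b i T = (\<Prod>j\<in>T. e i j * \<rho> i)"
    if "i \<in> I" "T \<subseteq> nbr_row i" "T \<noteq> {}" for i T
    using row_product[OF that \<rho>(2)[OF that(1)]] unfolding e_def .
  have dS: "c {j} * \<sigma> j * d j S = (\<Prod>i\<in>S. e i j * \<rho> i)"
    if "j \<in> J" "S \<subseteq> nbr_col j" "S \<noteq> {}" for j S
  proof -
    have "c {j} * \<sigma> j * d j S = (\<Prod>i\<in>S. c {j} * d j {i} * \<sigma> j)"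
      by (rule coefficient_system.row_product[OF transpose, unfolded nbr_transpose norm_transpose,
            OF that \<sigma>(2)[OF that(1)]])
    also have "\<dots> = (\<Prod>i\<in>S. e i j * \<rho> i)"
    proof (intro prod.cong refl)
      fix i assume "i \<in> S"
      then have "i \<in> I" "j \<in> nbr_row i" using that nbr_col_sub nbr_iff by blast+
      then show "c {j} * d j {i} * \<sigma> j = e i j * \<rho> i"
        using coeff_edge[of i j] \<rho>\<sigma> that(1) by (simp add: e_def)
    qed
    finally show ?thesis .
  qed
  have k: "e i j * \<rho> i \<noteq> 0" if "i \<in> I" "j \<in> nbr_row i" for i j
    using that a_single \<rho>(1) unfolding e_def nbr_row_def by auto
  have u: "a {i} * \<rho> i \<noteq> 0" if "i \<in> I" for i using that a_single \<rho>(1) by auto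
  have v: "c {j} * \<sigma> j \<noteq> 0" if "j \<in> J" for j using that c_single \<sigma>(1) by auto
  show thesis
    by (rule that[OF u v k bT dS balance[OF _ u v k bT dS]])
qed

end

section \<open>Expansion into blocks\<close>

lemma sum_prod_expand:
  fixes A :: "'i set \<Rightarrow> real" and B :: "'i \<Rightarrow> 'j set \<Rightarrow> real"
  assumes "finite K" "\<And>i. i \<in> K \<Longrightarrow> finite (J i)"
  shows "(\<Sum>U\<in>Pow K. A U * (\<Prod>i\<in>U. \<Sum>T\<in>Pow (J i) - {{}}. B i T))
    = (\<Sum>W\<in>Pow (Sigma K J). A (fst ` W) * (\<Prod>i\<in>fst ` W. B i (W `` {i})))"
proof -
  let ?P = "\<lambda>U. PiE U (\<lambda>i. Pow (J i) - {{}})"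
  have fin: "finite U" if "U \<in> Pow K" for U using that assms(1) finite_subset by auto
  have finP: "finite (?P U)" if "U \<in> Pow K" for U
    using that fin assms(2) by (intro finite_PiE) auto
  have "(\<Prod>i\<in>U. \<Sum>T\<in>Pow (J i) - {{}}. B i T) = (\<Sum>q\<in>?P U. \<Prod>i\<in>U. B i (q i))"
    if "U \<in> Pow K" for U
    using that assms(2) fin by (intro prod_sum_PiE) auto
  then have "(\<Sum>U\<in>Pow K. A U * (\<Prod>i\<in>U. \<Sum>T\<in>Pow (J i) - {{}}. B i T))
      = (\<Sum>U\<in>Pow K. \<Sum>q\<in>?P U. A U * (\<Prod>i\<in>U. B i (q i)))"
    by (simp add: sum_distrib_left)
  also have "\<dots> = (\<Sum>(U, q)\<in>Sigma (Pow K) ?P. A U * (\<Prod>i\<in>U. B i (q i)))"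
    using assms(1) finP by (intro sum.Sigma) auto
  also have "\<dots> = (\<Sum>W\<in>Pow (Sigma K J). A (fst ` W) * (\<Prod>i\<in>fst ` W. B i (W `` {i})))"
  proof (rule sum.reindex_bij_witness[of _ "\<lambda>W. (fst ` W, \<lambda>i\<in>fst ` W. W `` {i})"
        "\<lambda>(U, q). Sigma U q"])
    fix p assume "p \<in> Sigma (Pow K) ?P"
    then obtain U q where p: "p = (U, q)" "U \<subseteq> K" "q \<in> ?P U" by auto
    then have ne: "q i \<noteq> {}" "q i \<subseteq> J i" if "i \<in> U" for i using that by (auto simp: PiE_iff)
    have U: "fst ` Sigma U q = U" using ne by force
    have q: "Sigma U q `` {i} = q i" if "i \<in> U" for i using that by auto
    have "(\<lambda>i\<in>U. Sigma U q `` {i}) = q"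
      using p(3) q by (auto simp: fun_eq_iff restrict_def PiE_iff extensional_def)
    then show "(fst ` (case p of (U, q) \<Rightarrow> Sigma U q),
        \<lambda>i\<in>fst ` (case p of (U, q) \<Rightarrow> Sigma U q). (case p of (U, q) \<Rightarrow> Sigma U q) `` {i}) = p"
      using U by (simp add: p)
    show "(case p of (U, q) \<Rightarrow> Sigma U q) \<in> Pow (Sigma K J)"
      using p ne by auto
    show "A (fst ` (case p of (U, q) \<Rightarrow> Sigma U q)) * (\<Prod>i\<in>fst ` (case p of (U, q) \<Rightarrow> Sigma U q).
          B i ((case p of (U, q) \<Rightarrow> Sigma U q) `` {i}))
        = (case p of (U, q) \<Rightarrow> A U * (\<Prod>i\<in>U. B i (q i)))"
      using U q by (simp add: p)
  next
    fix W assume W: "W \<in> Pow (Sigma K J)"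
    have "Sigma (fst ` W) (\<lambda>i\<in>fst ` W. W `` {i}) = Sigma (fst ` W) (\<lambda>i. W `` {i})"
      by (intro Sigma_cong) auto
    also have "\<dots> = W" by force
    finally show "(case (fst ` W, \<lambda>i\<in>fst ` W. W `` {i}) of (U, q) \<Rightarrow> Sigma U q) = W" by simp
    show "(fst ` W, \<lambda>i\<in>fst ` W. W `` {i}) \<in> Sigma (Pow K) ?P" using W by (auto simp: PiE_iff)
  qed
  finally show ?thesis .
qed

text \<open>A set \<open>S\<close> is given by the blocks it meets and a nonempty part of each.
  Summing over the nonempty parts of one block gives the full product minus 1, the 1 being the term
  of the empty part.\<close>

lemma sum_prod_blocks:
  fixes \<Psi> :: "'t set \<Rightarrow> real" and w :: "'i \<Rightarrow> real"
  assumes "finite K" "\<And>t. t \<in> K \<Longrightarrow> finite (X t)"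
    and disj: "\<And>s t. s \<in> K \<Longrightarrow> t \<in> K \<Longrightarrow> s \<noteq> t \<Longrightarrow> X s \<inter> X t = {}"
  shows "(\<Sum>S\<in>Pow (\<Union>t\<in>K. X t). \<Psi> {t \<in> K. X t \<inter> S \<noteq> {}} * (\<Prod>i\<in>S. w i))
    = (\<Sum>U\<in>Pow K. \<Psi> U * (\<Prod>t\<in>U. (\<Prod>i\<in>X t. 1 + w i) - 1))"
proof -
  have "(\<Prod>i\<in>X t. 1 + w i) - 1 = (\<Sum>T\<in>Pow (X t) - {{}}. \<Prod>i\<in>T. w i)" if "t \<in> K" for t
  proof -
    have "(\<Prod>i\<in>X t. w i + 1) = (\<Sum>T\<in>Pow (X t). \<Prod>i\<in>T. w i)"
      by (subst prod_add[OF assms(2)[OF that]]) simp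
    also have "\<dots> = 1 + (\<Sum>T\<in>Pow (X t) - {{}}. \<Prod>i\<in>T. w i)"
      using assms(2)[OF that] by (subst sum.remove[of _ "{}"]) auto
    finally show ?thesis by (simp add: add.commute)
  qed
  then have "(\<Sum>U\<in>Pow K. \<Psi> U * (\<Prod>t\<in>U. (\<Prod>i\<in>X t. 1 + w i) - 1))
      = (\<Sum>U\<in>Pow K. \<Psi> U * (\<Prod>t\<in>U. \<Sum>T\<in>Pow (X t) - {{}}. \<Prod>i\<in>T. w i))"
    by (intro sum.cong refl arg_cong2[of _ _ _ _ "(*)"] prod.cong) auto
  also have "\<dots> = (\<Sum>W\<in>Pow (Sigma K X). \<Psi> (fst ` W) * (\<Prod>t\<in>fst ` W. \<Prod>i\<in>W `` {t}. w i))"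
    using assms(1,2) by (rule sum_prod_expand)
  also have "\<dots> = (\<Sum>S\<in>Pow (\<Union>t\<in>K. X t). \<Psi> {t \<in> K. X t \<inter> S \<noteq> {}} * (\<Prod>i\<in>S. w i))"
  \<comment> \<open>\<open>W\<close> is \<open>S\<close> with every element tagged by its block;
    disjointness makes the tag unique.\<close>
  proof (rule sum.reindex_bij_witness[of _ "\<lambda>S. Sigma K (\<lambda>t. X t \<inter> S)" "\<lambda>W. snd ` W"])
    fix W assume "W \<in> Pow (Sigma K X)"
    then have W: "W \<subseteq> Sigma K X" by simp
    have eq: "t = s" if "(t, i) \<in> Sigma K X" "(s, i) \<in> Sigma K X" for s t i
      using that disj[of s t] by auto
    have inj: "inj_on snd W"
    proof (rule inj_onI)
      fix p q assume "p \<in> W" "q \<in> W" "snd p = snd q"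
      then show "p = q" using eq[of "fst p" "snd p" "fst q"] W by (metis prod.collapse subsetD)
    qed
    show SW: "Sigma K (\<lambda>t. X t \<inter> snd ` W) = W"
    proof
      show "Sigma K (\<lambda>t. X t \<inter> snd ` W) \<subseteq> W"
      proof
        fix p assume p: "p \<in> Sigma K (\<lambda>t. X t \<inter> snd ` W)"
        then obtain s where s: "(s, snd p) \<in> W" by auto
        moreover have "(fst p, snd p) \<in> Sigma K X" using p by auto
        ultimately have "fst p = s" using eq W by blast
        then show "p \<in> W" using s by auto
      qed
      show "W \<subseteq> Sigma K (\<lambda>t. X t \<inter> snd ` W)" using W by force
    qed
    show "snd ` W \<in> Pow (\<Union>t\<in>K. X t)" using W by force
    have "finite W" using W assms(1,2) by (meson finite_SigmaI finite_subset)
    then have "(\<Prod>t\<in>fst ` W. \<Prod>i\<in>W `` {t}. w i) = (\<Prod>(t, i)\<in>W. w i)"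
      by (rule prod_over_rows)
    also have "\<dots> = (\<Prod>i\<in>snd ` W. w i)"
      by (subst prod.reindex[OF inj]) (simp add: case_prod_unfold)
    finally have "(\<Prod>t\<in>fst ` W. \<Prod>i\<in>W `` {t}. w i) = (\<Prod>i\<in>snd ` W. w i)" .
    moreover have "{t \<in> K. X t \<inter> snd ` W \<noteq> {}} = fst ` W"
    proof -
      have "{t \<in> K. X t \<inter> snd ` W \<noteq> {}} = fst ` Sigma K (\<lambda>t. X t \<inter> snd ` W)" by force
      then show ?thesis by (simp only: SW)
    qed
    ultimately show "\<Psi> {t \<in> K. X t \<inter> snd ` W \<noteq> {}} * (\<Prod>i\<in>snd ` W. w i)
        = \<Psi> (fst ` W) * (\<Prod>t\<in>fst ` W. \<Prod>i\<in>W `` {t}. w i)" by simp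
  next
    fix S assume "S \<in> Pow (\<Union>t\<in>K. X t)"
    then show "snd ` Sigma K (\<lambda>t. X t \<inter> S) = S" by force
    show "Sigma K (\<lambda>t. X t \<inter> S) \<in> Pow (Sigma K X)" by auto
  qed
  finally show ?thesis by simp
qed

section \<open>Connected components of a bipartite graph\<close>

lemma bipartite_components:
  fixes E :: "('i \<times> 'j) set"
  assumes "finite E"
  obtains k :: nat and X :: "nat \<Rightarrow> 'i set" where
    "(\<Union>t\<in>{1..k}. X t) = fst ` E"
    "\<And>t. t \<in> {1..k} \<Longrightarrow> X t \<noteq> {}"
    "\<And>s t. s \<in> {1..k} \<Longrightarrow> t \<in> {1..k} \<Longrightarrow> s \<noteq> t \<Longrightarrow> X s \<inter> X t = {}"
    "\<And>t i i' j. t \<in> {1..k} \<Longrightarrow> i \<in> X t \<Longrightarrow> (i, j) \<in> E \<Longrightarrow> (i', j) \<in> E \<Longrightarrow> i' \<in> X t"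
    "\<And>t i i'. t \<in> {1..k} \<Longrightarrow> i \<in> X t \<Longrightarrow> i' \<in> X t \<Longrightarrow> (i, i') \<in> (E O E\<inverse>)\<^sup>*"
proof -
  let ?I = "fst ` E"
  \<comment> \<open>The closure is reflexive on the whole type; the intersection removes vertices
    without edges, which would otherwise form classes of their own.\<close>
  define r where "r = (E O E\<inverse>)\<^sup>* \<inter> ?I \<times> ?I"
  have "sym (E O E\<inverse>)" by (auto simp: sym_def)
  then have "sym ((E O E\<inverse>)\<^sup>*)" by (rule sym_rtrancl)
  then have r: "equiv ?I r"
    unfolding r_def by (intro equivI) (auto simp: refl_on_def sym_def trans_def intro: rtrancl_trans)
  have "finite (?I // r)"
    using assms by (intro finite_quotient) (auto simp: r_def)
  then obtain X where X: "bij_betw X {1..card (?I // r)} (?I // r)"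
    using ex_bij_betw_nat_finite_1 by blast
  then have XQ: "X t \<in> ?I // r" if "t \<in> {1..card (?I // r)}" for t
    using that by (rule bij_betwE[THEN bspec])
  show thesis
  proof (rule that[of X "card (?I // r)"])
    show "(\<Union>t\<in>{1..card (?I // r)}. X t) = ?I"
      using Union_quotient[OF r] X by (simp add: bij_betw_def)
    show "X t \<noteq> {}" if "t \<in> {1..card (?I // r)}" for t
      using in_quotient_imp_non_empty[OF r XQ[OF that]] .
    show "X s \<inter> X t = {}" if "s \<in> {1..card (?I // r)}" "t \<in> {1..card (?I // r)}" "s \<noteq> t" for s t
    proof -
      have "X s \<noteq> X t" using that X unfolding bij_betw_def inj_on_def by blast
      then show ?thesis using quotient_disj[OF r XQ[OF that(1)] XQ[OF that(2)]] by blast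
    qed
    show "(i, i') \<in> (E O E\<inverse>)\<^sup>*" if "t \<in> {1..card (?I // r)}" "i \<in> X t" "i' \<in> X t" for t i i'
    proof -
      have "(i, i') \<in> r" using in_quotient_imp_in_rel[OF r XQ[OF that(1)]] that(2,3) by blast
      then show ?thesis unfolding r_def by blast
    qed
    show "i' \<in> X t" if "t \<in> {1..card (?I // r)}" "i \<in> X t" "(i, j) \<in> E" "(i', j) \<in> E" for t i i' j
    proof -
      have "(i, i') \<in> r" using that(3,4) unfolding r_def by force
      then show ?thesis using in_quotient_imp_closed[OF r XQ[OF that(1)] that(2)] by blast
    qed
  qed
qed

lemma balanced_saturate:
  fixes \<phi> :: "'i set \<Rightarrow> 'v"
  assumes "finite E" and bal: "\<And>W. W \<subseteq> E \<Longrightarrow> \<phi> (fst ` W) = \<chi> (snd ` W)" and S: "S \<subseteq> fst ` E"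
  shows "\<phi> S = \<phi> ((E O E\<inverse>)\<^sup>* `` S)"
proof -
  let ?R = "E O E\<inverse>"
  have step: "\<phi> Q = \<phi> (?R `` Q)" if "Q \<subseteq> fst ` E" for Q
  proof -
    let ?W = "{e \<in> E. fst e \<in> Q}" and ?V = "{e \<in> E. snd e \<in> E `` Q}"
    have "fst ` ?W = Q" "snd ` ?W = E `` Q" "fst ` ?V = ?R `` Q" "snd ` ?V = E `` Q"
      using that by force+
    then show ?thesis using bal[of ?W] bal[of ?V] by auto
  qed
  have sub: "?R\<^sup>* `` S \<subseteq> fst ` E"
  proof
    fix i assume "i \<in> ?R\<^sup>* `` S"
    then obtain i0 where "i0 \<in> S" "(i0, i) \<in> ?R\<^sup>*" by auto
    from this(2,1) show "i \<in> fst ` E"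
      by (cases rule: rtranclE) (use S in \<open>auto intro: rev_image_eqI\<close>)
  qed
  define \<A> where "\<A> = {Q. S \<subseteq> Q \<and> Q \<subseteq> ?R\<^sup>* `` S \<and> \<phi> Q = \<phi> S}"
  have "finite \<A>"
  proof (rule finite_subset)
    show "\<A> \<subseteq> Pow (fst ` E)" using sub unfolding \<A>_def by auto
  qed (use assms(1) in simp)
  moreover have "S \<in> \<A>" unfolding \<A>_def by auto
  ultimately obtain Q where Q: "Q \<in> \<A>" and max: "\<And>Q'. Q' \<in> \<A> \<Longrightarrow> Q \<subseteq> Q' \<Longrightarrow> Q = Q'"
    using finite_has_maximal[of \<A>] by blast
  have QI: "Q \<subseteq> fst ` E" and SQ: "S \<subseteq> Q" and QR: "Q \<subseteq> ?R\<^sup>* `` S" and \<phi>Q: "\<phi> Q = \<phi> S"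
    using Q sub unfolding \<A>_def by auto
  have "Q \<subseteq> ?R `` Q" using QI by force
  moreover have "?R `` Q \<subseteq> ?R\<^sup>* `` S" using QR by (blast intro: rtrancl_into_rtrancl)
  ultimately have "?R `` Q \<in> \<A>" using SQ \<phi>Q step[OF QI] unfolding \<A>_def by auto
  then have closed: "?R `` Q = Q" using max \<open>Q \<subseteq> ?R `` Q\<close> by blast
  then have "?R\<^sup>* `` Q = Q" by (simp add: Image_closed_trancl)
  then have "?R\<^sup>* `` S \<subseteq> Q" using SQ by blast
  then show ?thesis using QR \<phi>Q by (simp add: subset_antisym)
qed

lemma balanced_block_function:
  fixes \<phi> :: "'i set \<Rightarrow> 'v" and \<chi> :: "'j set \<Rightarrow> 'v"
  assumes E: "finite E" and bal: "\<And>W. W \<subseteq> E \<Longrightarrow> \<phi> (fst ` W) = \<chi> (snd ` W)"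
    and cover: "(\<Union>t\<in>K. X t) = fst ` E"
    and closed: "\<And>t i i' j. t \<in> K \<Longrightarrow> i \<in> X t \<Longrightarrow> (i, j) \<in> E \<Longrightarrow> (i', j) \<in> E \<Longrightarrow> i' \<in> X t"
    and conn: "\<And>t i i'. t \<in> K \<Longrightarrow> i \<in> X t \<Longrightarrow> i' \<in> X t \<Longrightarrow> (i, i') \<in> (E O E\<inverse>)\<^sup>*"
  shows "S \<subseteq> fst ` E \<Longrightarrow> \<phi> S = \<phi> (\<Union>t\<in>{t \<in> K. X t \<inter> S \<noteq> {}}. X t)"
    and "T \<subseteq> snd ` E \<Longrightarrow> \<chi> T = \<phi> (\<Union>t\<in>{t \<in> K. E `` X t \<inter> T \<noteq> {}}. X t)"
proof -
  have closed': "i' \<in> X t" if "(i, i') \<in> (E O E\<inverse>)\<^sup>*" "t \<in> K" "i \<in> X t" for t i i'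
    using that by (induction rule: rtrancl_induct) (auto intro: closed)
  show row: "\<phi> S = \<phi> (\<Union>t\<in>{t \<in> K. X t \<inter> S \<noteq> {}}. X t)" if S: "S \<subseteq> fst ` E" for S
  proof -
    have "(E O E\<inverse>)\<^sup>* `` S = (\<Union>t\<in>{t \<in> K. X t \<inter> S \<noteq> {}}. X t)"
    proof (intro subset_antisym subsetI)
      fix i assume "i \<in> (E O E\<inverse>)\<^sup>* `` S"
      then obtain i0 where i0: "i0 \<in> S" "(i0, i) \<in> (E O E\<inverse>)\<^sup>*" by auto
      then obtain t where "t \<in> K" "i0 \<in> X t" using S cover by blast
      then show "i \<in> (\<Union>t\<in>{t \<in> K. X t \<inter> S \<noteq> {}}. X t)" using i0 closed' by blast
    next
      fix i assume "i \<in> (\<Union>t\<in>{t \<in> K. X t \<inter> S \<noteq> {}}. X t)"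
      then show "i \<in> (E O E\<inverse>)\<^sup>* `` S" using conn by blast
    qed
    then show ?thesis using balanced_saturate[of E \<phi> \<chi> S, OF E bal S] by simp
  qed
  show "\<chi> T = \<phi> (\<Union>t\<in>{t \<in> K. E `` X t \<inter> T \<noteq> {}}. X t)" if T: "T \<subseteq> snd ` E"
  proof -
    let ?W = "{e \<in> E. snd e \<in> T}"
    have W: "snd ` ?W = T" "fst ` ?W = E\<inverse> `` T" using T by force+
    have "{t \<in> K. X t \<inter> E\<inverse> `` T \<noteq> {}} = {t \<in> K. E `` X t \<inter> T \<noteq> {}}" by blast
    then show ?thesis using bal[of ?W] row[of "E\<inverse> `` T"] W by force
  qed
qed

section \<open>The generic base point\<close>

lemma depends_only_compose_rows:
  assumes "depends_only I p" "\<And>i. i \<in> I \<Longrightarrow> depends_only J (q i)"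
  shows "depends_only (I \<times> J) (\<lambda>z. p (\<lambda>i. q i (\<lambda>j. z (i, j))))"
  unfolding depends_only_def
proof (intro allI impI)
  fix y z :: "'a \<times> 'b \<Rightarrow> real" assume eq: "\<forall>e\<in>I \<times> J. y e = z e"
  show "p (\<lambda>i. q i (\<lambda>j. y (i, j))) = p (\<lambda>i. q i (\<lambda>j. z (i, j)))"
  proof (rule depends_onlyD[OF assms(1)])
    fix i assume "i \<in> I"
    then show "q i (\<lambda>j. y (i, j)) = q i (\<lambda>j. z (i, j))"
      using eq by (intro depends_onlyD[OF assms(2)]) auto
  qed
qed

lemma depends_only_row:
  assumes "depends_only J p" "i \<in> I"
  shows "depends_only (I \<times> J) (\<lambda>z. p (\<lambda>j. z (i, j)))"
  using assms unfolding depends_only_def by simp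

lemma depends_only_transpose:
  assumes "depends_only (J \<times> I) p"
  shows "depends_only (I \<times> J) (\<lambda>z. p (\<lambda>(j, i). z (i, j)))"
  using assms unfolding depends_only_def by auto

text \<open>Dependence on \<open>i\<close> gives a coordinate line on which the extension is a
  non-constant affine function, and such a function takes every real value.\<close>

lemma mlext_surj:
  assumes "finite I" "i \<in> Dep I f"
  shows "\<exists>x. mlext I f x = c"
proof -
  obtain x where x: "x \<in> sign_cube I" "f (x(i := 1)) \<noteq> f (x(i := -1))" and i: "i \<in> I"
    using assms(2) unfolding Dep_def by auto
  have "x(i := 1) \<in> sign_cube I" "x(i := -1) \<in> sign_cube I"
    using x(1) i unfolding sign_cube_def by (auto simp: PiE_iff extensional_def)
  then have "mlext I f (x(i := 1)) \<noteq> mlext I f (x(i := -1))"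
    using x(2) by (simp add: mlext_sign_cube[OF assms(1)])
  then show ?thesis
    using multiaffine_surj[OF multiaffine_mlext[OF assms(1)] i] by blast
qed

text \<open>The outer function is expanded at the vector of inner values, so a single
  \<open>z\<close> is the base point of all expansions.\<close>

definition row_generic ::
    "'i set \<Rightarrow> 'j set \<Rightarrow> (('i \<Rightarrow> real) \<Rightarrow> real) \<Rightarrow> ('i \<Rightarrow> ('j \<Rightarrow> real) \<Rightarrow> real)
      \<Rightarrow> ('i \<times> 'j \<Rightarrow> real) \<Rightarrow> bool" where
  "row_generic I J p q z \<longleftrightarrow>
     (\<forall>S. below_supp I p S \<longrightarrow> taylor_coeff I p (\<lambda>i. mlext J (q i) (\<lambda>j. z (i, j))) S \<noteq> 0) \<and>
     (\<forall>i\<in>I. \<forall>T. below_supp J (q i) T \<longrightarrow> taylor_coeff J (q i) (\<lambda>j. z (i, j)) T \<noteq> 0)"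

text \<open>For the outer conditions, the rows of \<open>z\<close> are independent and each
  \<open>q i\<close> is onto the reals, so the inner values can be any point where the outer
  coefficient is nonzero. The result is a finite list of conditions and not yet a point, since row
  and column conditions must later hold at the same \<open>z\<close>.\<close>

lemma row_generic_conditions:
  fixes q :: "'i \<Rightarrow> ('j \<Rightarrow> real) \<Rightarrow> real"
  assumes I: "finite I" and J: "finite J" and q: "\<And>i. i \<in> I \<Longrightarrow> Dep J (q i) \<noteq> {}"
  obtains P where "finite P" "\<And>F. F \<in> P \<Longrightarrow> multiaffine (I \<times> J) F"
    "\<And>F. F \<in> P \<Longrightarrow> depends_only (I \<times> J) F" "\<And>F. F \<in> P \<Longrightarrow> \<exists>z. F z \<noteq> 0"
    "\<And>z. (\<And>F. F \<in> P \<Longrightarrow> F z \<noteq> 0) \<Longrightarrow> row_generic I J p q z"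
proof -
  define outer where "outer S z = taylor_coeff I p (\<lambda>i. mlext J (q i) (\<lambda>j. z (i, j))) S" for S z
  define inner where "inner i T z = taylor_coeff J (q i) (\<lambda>j. z (i, j)) T" for i :: 'i and T z
  define P where "P = outer ` {S. below_supp I p S} \<union>
    (\<lambda>(i, T). inner i T) ` (SIGMA i:I. {T. below_supp J (q i) T})"
  have outer: "multiaffine (I \<times> J) (outer S)" "depends_only (I \<times> J) (outer S)" for S
    unfolding outer_def
    by (intro multiaffine_compose_rows[of I "\<lambda>x. taylor_coeff I p x S"]
          multiaffine_taylor_coeff multiaffine_mlext I J,
        intro depends_only_compose_rows[of I "\<lambda>x. taylor_coeff I p x S"]
          depends_only_taylor_coeff depends_only_mlext)
  have inner: "multiaffine (I \<times> J) (inner i T)" "i \<in> I \<Longrightarrow> depends_only (I \<times> J) (inner i T)" for i T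
    unfolding inner_def
    by (intro multiaffine_row[of J "\<lambda>x. taylor_coeff J (q i) x T"] multiaffine_taylor_coeff J,
        intro depends_only_row[of J "\<lambda>x. taylor_coeff J (q i) x T"] depends_only_taylor_coeff)
  have "\<exists>z. outer S z \<noteq> 0" if S: "below_supp I p S" for S
  proof -
    obtain x where x: "taylor_coeff I p x S \<noteq> 0" using taylor_coeff_nonzero[OF I S] by blast
    have "\<forall>i. \<exists>y. i \<in> I \<longrightarrow> mlext J (q i) y = x i" using mlext_surj[OF J] q by blast
    then obtain y where y: "\<And>i. i \<in> I \<Longrightarrow> mlext J (q i) (y i) = x i" by metis
    have "outer S (\<lambda>(i, j). y i j) = taylor_coeff I p x S"
      unfolding outer_def using y by (intro depends_onlyD[OF depends_only_taylor_coeff]) simp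
    with x show ?thesis by metis
  qed
  moreover have "\<exists>z. inner i T z \<noteq> 0" if T: "below_supp J (q i) T" for i T
  proof -
    obtain y where "taylor_coeff J (q i) y T \<noteq> 0" using taylor_coeff_nonzero[OF J T] by blast
    then have "inner i T (\<lambda>(i, j). y j) \<noteq> 0" unfolding inner_def by simp
    then show ?thesis by blast
  qed
  ultimately have nz: "\<exists>z. F z \<noteq> 0" if "F \<in> P" for F using that unfolding P_def by auto
  have "finite {S. below_supp I p S}" "finite (SIGMA i:I. {T. below_supp J (q i) T})"
    using I J by (auto intro!: finite_SigmaI finite_subset[of "{S. below_supp I p S}" "Pow I"]
        finite_subset[of "{S. below_supp J _ S}" "Pow J"] dest: below_supp_subset)
  then have "finite P" unfolding P_def by blast
  then show thesis
  proof (rule that)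
    show "row_generic I J p q z" if nz: "\<And>F. F \<in> P \<Longrightarrow> F z \<noteq> 0" for z
      unfolding row_generic_def
    proof (intro conjI allI impI ballI)
      fix S assume "below_supp I p S"
      then have "outer S \<in> P" unfolding P_def by blast
      from nz[OF this] show "taylor_coeff I p (\<lambda>i. mlext J (q i) (\<lambda>j. z (i, j))) S \<noteq> 0"
        unfolding outer_def .
    next
      fix i T assume "i \<in> I" "below_supp J (q i) T"
      then have "inner i T \<in> P" unfolding P_def by (intro UnI2 rev_image_eqI[of "(i, T)"]) auto
      from nz[OF this] show "taylor_coeff J (q i) (\<lambda>j. z (i, j)) T \<noteq> 0"
        unfolding inner_def .
    qed
  qed (use outer inner nz in \<open>auto simp: P_def\<close>)
qed

lemma generic_point:
  assumes I: "finite I" and J: "finite J"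
    and g: "\<And>i. i \<in> I \<Longrightarrow> Dep J (g i) \<noteq> {}" and f: "\<And>j. j \<in> J \<Longrightarrow> Dep I (f j) \<noteq> {}"
  obtains z where "row_generic I J f0 g z" "row_generic J I g0 f (\<lambda>(j, i). z (i, j))"
proof -
  obtain P where P: "finite P" "\<And>F. F \<in> P \<Longrightarrow> multiaffine (I \<times> J) F"
    "\<And>F. F \<in> P \<Longrightarrow> depends_only (I \<times> J) F" "\<And>F. F \<in> P \<Longrightarrow> \<exists>z. F z \<noteq> 0"
    "\<And>z. (\<And>F. F \<in> P \<Longrightarrow> F z \<noteq> 0) \<Longrightarrow> row_generic I J f0 g z"
    using row_generic_conditions[OF I J g, of "\<lambda>x. x" f0] by metis
  obtain Q where Q: "finite Q" "\<And>F. F \<in> Q \<Longrightarrow> multiaffine (J \<times> I) F"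
    "\<And>F. F \<in> Q \<Longrightarrow> depends_only (J \<times> I) F" "\<And>F. F \<in> Q \<Longrightarrow> \<exists>z. F z \<noteq> 0"
    "\<And>z. (\<And>F. F \<in> Q \<Longrightarrow> F z \<noteq> 0) \<Longrightarrow> row_generic J I g0 f z"
    using row_generic_conditions[OF J I f, of "\<lambda>x. x" g0] by metis
  \<comment> \<open>Pulls the conditions for the transposed matrix back to the variable
    \<open>z\<close> of the row conditions.\<close>
  define \<tau> where "\<tau> F z = F (\<lambda>(j, i). z (i, j))" for F :: "('b \<times> 'a \<Rightarrow> real) \<Rightarrow> real" and z
  have "\<exists>z. \<forall>F\<in>P \<union> \<tau> ` Q. F z \<noteq> 0"
  proof (rule multiaffine_common_nonzero[of "I \<times> J"])
    fix F assume "F \<in> P \<union> \<tau> ` Q"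
    then consider "F \<in> P" | G where "G \<in> Q" "F = \<tau> G" by blast
    note cs = this
    show "multiaffine (I \<times> J) F"
      using cs by cases (use P(2) Q(2) in \<open>auto simp: \<tau>_def[abs_def] intro: multiaffine_transpose\<close>)
    show "depends_only (I \<times> J) F"
      using cs by cases (use P(3) Q(3) in \<open>auto simp: \<tau>_def[abs_def] intro: depends_only_transpose\<close>)
    show "\<exists>z. F z \<noteq> 0"
      using cs
    proof cases
      case 2
      then obtain z where "G z \<noteq> 0" using Q(4) by blast
      then have "F (\<lambda>(i, j). z (j, i)) \<noteq> 0" unfolding 2 \<tau>_def by (simp add: case_prod_beta)
      then show ?thesis by blast
    qed (use P(4) in blast)
  qed (use I J P(1) Q(1) in auto)
  then obtain z where z: "\<And>F. F \<in> P \<union> \<tau> ` Q \<Longrightarrow> F z \<noteq> 0" by blast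
  show thesis
  proof (rule that)
    show "row_generic I J f0 g z" using z by (intro P(5)) blast
    show "row_generic J I g0 f (\<lambda>(j, i). z (i, j))"
    proof (rule Q(5))
      fix F assume "F \<in> Q"
      then show "F (\<lambda>(j, i). z (i, j)) \<noteq> 0" using z[of "\<tau> F"] by (simp add: \<tau>_def)
    qed
  qed
qed

section \<open>Comparing the two Taylor expansions\<close>

text \<open>The increments of the inner functions are substituted into the outer expansion. Distinct
  rows use distinct variables, so each product of inner terms is the monomial of a unique
  \<open>W\<close>.\<close>

lemma mlext_compose_taylor:
  assumes I: "finite I" and J: "finite J"
  shows "mlext I p (\<lambda>i. mlext J (q i) (\<lambda>j. z (i, j)))
    = (\<Sum>W\<in>Pow (I \<times> J). taylor_coeff I p (\<lambda>i. mlext J (q i) (\<lambda>j. z0 (i, j))) (fst ` W)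
        * (\<Prod>i\<in>fst ` W. taylor_coeff J (q i) (\<lambda>j. z0 (i, j)) (W `` {i})) * (\<Prod>e\<in>W. z e - z0 e))"
proof -
  let ?a = "taylor_coeff I p (\<lambda>i. mlext J (q i) (\<lambda>j. z0 (i, j)))"
  let ?b = "\<lambda>i. taylor_coeff J (q i) (\<lambda>j. z0 (i, j))"
  have "mlext I p (\<lambda>i. mlext J (q i) (\<lambda>j. z (i, j)))
      = (\<Sum>S\<in>Pow I. ?a S * (\<Prod>i\<in>S. \<Sum>T\<in>Pow J - {{}}. ?b i T * (\<Prod>j\<in>T. z (i, j) - z0 (i, j))))"
    unfolding mlext_taylor[OF I, of p _ "\<lambda>i. mlext J (q i) (\<lambda>j. z0 (i, j))"]
      mlext_taylor_nonconst[OF J] ..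
  also have "\<dots> = (\<Sum>W\<in>Pow (I \<times> J). ?a (fst ` W) *
      (\<Prod>i\<in>fst ` W. ?b i (W `` {i}) * (\<Prod>j\<in>W `` {i}. z (i, j) - z0 (i, j))))"
    using I J by (rule sum_prod_expand)
  also have "\<dots> = (\<Sum>W\<in>Pow (I \<times> J). ?a (fst ` W) * (\<Prod>i\<in>fst ` W. ?b i (W `` {i})) * (\<Prod>e\<in>W. z e - z0 e))"
  proof (intro sum.cong refl)
    fix W assume "W \<in> Pow (I \<times> J)"
    then have "finite W" using I J by (meson PowD finite_SigmaI finite_subset)
    then have "(\<Prod>i\<in>fst ` W. \<Prod>j\<in>W `` {i}. z (i, j) - z0 (i, j)) = (\<Prod>e\<in>W. z e - z0 e)"
      using prod_over_rows[of W "\<lambda>i j. z (i, j) - z0 (i, j)"] by (simp add: case_prod_beta)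
    then show "?a (fst ` W) * (\<Prod>i\<in>fst ` W. ?b i (W `` {i}) * (\<Prod>j\<in>W `` {i}. z (i, j) - z0 (i, j)))
        = ?a (fst ` W) * (\<Prod>i\<in>fst ` W. ?b i (W `` {i})) * (\<Prod>e\<in>W. z e - z0 e)"
      by (simp add: prod.distrib)
  qed
  finally show ?thesis .
qed

text \<open>After translation by \<open>z0\<close>, both sides of the identity are multilinear
  polynomials in the same variables, so their coefficients agree.\<close>

lemma taylor_coeff_compare:
  assumes I: "finite I" and J: "finite J"
    and eq: "\<And>z. mlext I f0 (\<lambda>i. mlext J (g i) (\<lambda>j. z (i, j))) = mlext J g0 (\<lambda>j. mlext I (f j) (\<lambda>i. z (i, j)))"
    and W: "W \<subseteq> I \<times> J"
  shows "taylor_coeff I f0 (\<lambda>i. mlext J (g i) (\<lambda>j. z0 (i, j))) (fst ` W)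
      * (\<Prod>i\<in>fst ` W. taylor_coeff J (g i) (\<lambda>j. z0 (i, j)) (W `` {i}))
    = taylor_coeff J g0 (\<lambda>j. mlext I (f j) (\<lambda>i. z0 (i, j))) (snd ` W)
      * (\<Prod>j\<in>snd ` W. taylor_coeff I (f j) (\<lambda>i. z0 (i, j)) (W\<inverse> `` {j}))"
    (is "?L W = ?R W")
proof (rule polynomial_coeff_unique[of "I \<times> J" ?L ?R])
  fix x :: "'a \<times> 'b \<Rightarrow> real"
  let ?z = "\<lambda>e. x e + z0 e"
  have "(\<Sum>W\<in>Pow (I \<times> J). ?L W * (\<Prod>e\<in>W. x e)) = mlext I f0 (\<lambda>i. mlext J (g i) (\<lambda>j. ?z (i, j)))"
    using mlext_compose_taylor[OF I J, of f0 g ?z z0] by simp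
  also have "\<dots> = mlext J g0 (\<lambda>j. mlext I (f j) (\<lambda>i. ?z (i, j)))" by (rule eq)
  also have "\<dots> = (\<Sum>W\<in>Pow (J \<times> I). ?R (W\<inverse>) * (\<Prod>e\<in>W. x (snd e, fst e)))"
    using mlext_compose_taylor[OF J I, of g0 f "\<lambda>(j, i). ?z (i, j)" "\<lambda>(j, i). z0 (i, j)"]
    by (simp add: case_prod_beta image_def converse_unfold Bex_def)
  also have "\<dots> = (\<Sum>W\<in>Pow (I \<times> J). ?R W * (\<Prod>e\<in>W. x e))"
  proof (rule sum.reindex_bij_witness[of _ converse converse])
    fix W :: "('b \<times> 'a) set"
    have "(\<Prod>e\<in>W\<inverse>. x e) = (\<Prod>e\<in>W. x (snd e, fst e))"
      by (rule prod.reindex_bij_witness[of _ prod.swap prod.swap]) auto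
    then show "?R (W\<inverse>) * (\<Prod>e\<in>W\<inverse>. x e) = ?R (W\<inverse>) * (\<Prod>e\<in>W. x (snd e, fst e))" by simp
  qed auto
  finally show "(\<Sum>W\<in>Pow (I \<times> J). ?L W * (\<Prod>e\<in>W. x e)) = (\<Sum>W\<in>Pow (I \<times> J). ?R W * (\<Prod>e\<in>W. x e))" .
qed (use I J W in auto)

text \<open>Both compositions are affine in each entry of \<open>z\<close>, and at sign vectors each
  inner extension equals the inner function itself, where the hypothesis applies.\<close>

lemma polymorphism_everywhere:
  assumes "ml_gen_polymorphism n m f g"
  shows "mlext {1..n} (f 0) (\<lambda>i. mlext {1..m} (g i) (\<lambda>j. z (i, j)))
    = mlext {1..m} (g 0) (\<lambda>j. mlext {1..n} (f j) (\<lambda>i. z (i, j)))"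
proof (rule multiaffine_eqI[of "{1..n} \<times> {1..m}" "\<lambda>z. mlext {1..n} (f 0) (\<lambda>i. mlext {1..m} (g i) (\<lambda>j. z (i, j)))"
      "\<lambda>z. mlext {1..m} (g 0) (\<lambda>j. mlext {1..n} (f j) (\<lambda>i. z (i, j)))"])
  show "multiaffine ({1..n} \<times> {1..m}) (\<lambda>z. mlext {1..n} (f 0) (\<lambda>i. mlext {1..m} (g i) (\<lambda>j. z (i, j))))"
    by (intro multiaffine_compose_rows multiaffine_mlext) auto
  have "multiaffine ({1..m} \<times> {1..n}) (\<lambda>z. mlext {1..m} (g 0) (\<lambda>j. mlext {1..n} (f j) (\<lambda>i. z (j, i))))"
    by (intro multiaffine_compose_rows multiaffine_mlext) auto
  from multiaffine_transpose[OF this]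
  show "multiaffine ({1..n} \<times> {1..m}) (\<lambda>z. mlext {1..m} (g 0) (\<lambda>j. mlext {1..n} (f j) (\<lambda>i. z (i, j))))"
    by simp
next
  fix z :: "nat \<times> nat \<Rightarrow> real"
  assume z: "\<And>e. e \<in> {1..n} \<times> {1..m} \<Longrightarrow> z e = 1 \<or> z e = -1"
  let ?z = "restrict z ({1..n} \<times> {1..m})"
  have cube: "?z \<in> sign_cube ({1..n} \<times> {1..m})"
    using z unfolding sign_cube_def by (auto simp: PiE_iff)
  have g: "mlext {1..m} (g i) (\<lambda>j. z (i, j)) = g i (\<lambda>j\<in>{1..m}. ?z (i, j))" if "i \<in> {1..n}" for i
  proof -
    have "(\<lambda>j\<in>{1..m}. ?z (i, j)) \<in> sign_cube {1..m}"
      using z that unfolding sign_cube_def by (fastforce simp: PiE_iff)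
    from mlext_sign_cube[OF _ this, of "g i"] show ?thesis
      using mlext_cong[of "{1..m}" "\<lambda>j. z (i, j)" "\<lambda>j\<in>{1..m}. ?z (i, j)" "g i"] that by simp
  qed
  have f: "mlext {1..n} (f j) (\<lambda>i. z (i, j)) = f j (\<lambda>i\<in>{1..n}. ?z (i, j))" if "j \<in> {1..m}" for j
  proof -
    have "(\<lambda>i\<in>{1..n}. ?z (i, j)) \<in> sign_cube {1..n}"
      using z that unfolding sign_cube_def by (fastforce simp: PiE_iff)
    from mlext_sign_cube[OF _ this, of "f j"] show ?thesis
      using mlext_cong[of "{1..n}" "\<lambda>i. z (i, j)" "\<lambda>i\<in>{1..n}. ?z (i, j)" "f j"] that by simp
  qed
  have "mlext {1..n} (f 0) (\<lambda>i. mlext {1..m} (g i) (\<lambda>j. z (i, j)))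
      = mlext {1..n} (f 0) (\<lambda>i. g i (\<lambda>j\<in>{1..m}. ?z (i, j)))"
    by (rule mlext_cong) (rule g)
  also have "\<dots> = mlext {1..m} (g 0) (\<lambda>j. f j (\<lambda>i\<in>{1..n}. ?z (i, j)))"
    using assms cube unfolding ml_gen_polymorphism_def by blast
  also have "\<dots> = mlext {1..m} (g 0) (\<lambda>j. mlext {1..n} (f j) (\<lambda>i. z (i, j)))"
    by (rule mlext_cong) (rule f[symmetric])
  finally show "mlext {1..n} (f 0) (\<lambda>i. mlext {1..m} (g i) (\<lambda>j. z (i, j)))
      = mlext {1..m} (g 0) (\<lambda>j. mlext {1..n} (f j) (\<lambda>i. z (i, j)))" .
qed simp

section \<open>Degree and two-valued-likeness in terms of supports\<close>

lemma ml_degree_ge_2: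
  assumes "finite I" "ml_degree I f \<ge> 2"
  shows "\<exists>S\<in>fourier_supp I f. card S \<ge> 2"
proof -
  have "fourier_supp I f \<subseteq> Pow I" unfolding fourier_supp_def by auto
  then have "finite (fourier_supp I f)" using assms(1) by (simp add: finite_subset)
  then have "Max (insert 0 (card ` fourier_supp I f)) \<in> insert 0 (card ` fourier_supp I f)"
    by (intro Max_in) auto
  then show ?thesis using assms(2) unfolding ml_degree_def by auto
qed

lemma ml_degree_ge_2_Dep:
  assumes "finite I" "ml_degree I f \<ge> 2"
  shows "Dep I f \<noteq> {}"
proof -
  obtain S where S: "S \<in> fourier_supp I f" "card S \<ge> 2" using ml_degree_ge_2[OF assms] by blast
  then have "S \<noteq> {}" by auto
  then show ?thesis using S(1) Dep_iff_fourier_supp[OF assms(1)] by blast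
qed

text \<open>Degree at least 2 rules out a dictator, so some supporting set of size at least 2
  contains \<open>w\<close>, and any other element of it can serve as \<open>w'\<close>.\<close>

lemma two_valued_like_pair:
  assumes "finite I" "two_valued_like I f" "ml_degree I f \<ge> 2" "w \<in> Dep I f"
  shows "\<exists>w'\<in>I. w' \<noteq> w \<and> below_supp I f {w, w'}"
proof -
  have "\<not> dictator I f" using assms(2,3) unfolding two_valued_like_def by auto
  then obtain S where S: "S \<in> fourier_supp I f" "card S \<ge> 2" "w \<in> S"
    using assms(2,4) unfolding two_valued_like_def by blast
  have "\<not> S \<subseteq> {w}"
  proof
    assume "S \<subseteq> {w}"
    then have "card S \<le> 1" using card_mono[of "{w}" S] by simp
    then show False using S(2) by simp
  qed
  then obtain w' where "w' \<in> S" "w' \<noteq> w" by blast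
  then show ?thesis using S unfolding below_supp_def fourier_supp_def by blast
qed

section \<open>Assembling the structure\<close>

text \<open>The nonconstant Taylor terms, scaled by \<open>u\<close>, sum to the product of
  \<open>1 + k j * (y j - z j)\<close> over \<open>N\<close>, minus 1 for the missing empty set.
  Pulling out each \<open>k j\<close> gives the shifts and the leading constant.\<close>

lemma mlext_product_form:
  assumes J: "finite J" and N: "N \<subseteq> J" and u: "u \<noteq> 0" and k: "\<And>j. j \<in> N \<Longrightarrow> k j \<noteq> 0"
    and inside: "\<And>T. T \<subseteq> N \<Longrightarrow> T \<noteq> {} \<Longrightarrow> u * taylor_coeff J q z T = (\<Prod>j\<in>T. k j)"
    and outside: "\<And>T. T \<subseteq> J \<Longrightarrow> \<not> T \<subseteq> N \<Longrightarrow> taylor_coeff J q z T = 0"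
  shows "mlext J q y
    = (\<Prod>j\<in>N. k j) / u * (\<Prod>j\<in>N. y j + (1 / k j - z j)) + (mlext J q z - 1 / u)"
proof -
  let ?w = "\<lambda>j. k j * (y j - z j)"
  have fin: "finite N" using N J by (rule finite_subset)
  have "u * (mlext J q y - mlext J q z)
      = (\<Sum>T\<in>Pow J - {{}}. u * taylor_coeff J q z T * (\<Prod>j\<in>T. y j - z j))"
    unfolding mlext_taylor_nonconst[OF J] by (simp add: sum_distrib_left mult.assoc)
  also have "\<dots> = (\<Sum>T\<in>Pow N - {{}}. u * taylor_coeff J q z T * (\<Prod>j\<in>T. y j - z j))"
    using J N outside by (intro sum.mono_neutral_right) auto
  also have "\<dots> = (\<Sum>T\<in>Pow N - {{}}. \<Prod>j\<in>T. ?w j)"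
    using inside by (intro sum.cong refl) (simp add: prod.distrib)
  also have "\<dots> = (\<Sum>T\<in>Pow N. \<Prod>j\<in>T. ?w j) - 1"
    using fin by (subst (2) sum.remove[of _ "{}"]) auto
  also have "(\<Sum>T\<in>Pow N. \<Prod>j\<in>T. ?w j) = (\<Prod>j\<in>N. ?w j + 1)"
    by (subst prod_add[OF fin]) simp
  also have "\<dots> = (\<Prod>j\<in>N. k j * (y j + (1 / k j - z j)))"
    using k by (intro prod.cong refl) (simp add: field_simps)
  also have "\<dots> = (\<Prod>j\<in>N. k j) * (\<Prod>j\<in>N. y j + (1 / k j - z j))"
    by (rule prod.distrib)
  finally have "mlext J q y - mlext J q z
      = ((\<Prod>j\<in>N. k j) * (\<Prod>j\<in>N. y j + (1 / k j - z j)) - 1) / u"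
    using u by (simp add: eq_divide_eq mult.commute)
  then show ?thesis by (simp add: diff_divide_distrib)
qed

text \<open>Each factor \<open>1 + u i * (x i - G i)\<close> is \<open>l i\<close> times
  \<open>(x i - D) / C\<close> with \<open>D = G i - 1 / u i\<close> and
  \<open>C = l i / u i\<close>, the constants dictated by the inner functions. The factors
  \<open>l i\<close> of a block collect in \<open>L t\<close>.\<close>

lemma mlext_block_form:
  assumes K: "finite K" and X: "\<And>t. t \<in> K \<Longrightarrow> finite (X t)"
    and disj: "\<And>s t. s \<in> K \<Longrightarrow> t \<in> K \<Longrightarrow> s \<noteq> t \<Longrightarrow> X s \<inter> X t = {}"
    and I: "I = (\<Union>t\<in>K. X t)" and u: "\<And>i. i \<in> I \<Longrightarrow> u i \<noteq> 0" and l: "\<And>i. i \<in> I \<Longrightarrow> l i \<noteq> 0"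
    and L: "\<And>t. t \<in> K \<Longrightarrow> L t = (\<Prod>i\<in>X t. l i)"
    and coeff: "\<And>S. S \<subseteq> I \<Longrightarrow> taylor_coeff I p G S / (\<Prod>i\<in>S. u i) = \<Psi> {t \<in> K. X t \<inter> S \<noteq> {}}"
  shows "mlext I p x
    = (\<Sum>U\<in>Pow K. \<Psi> U * (\<Prod>t\<in>U. L t * (\<Prod>i\<in>X t. (x i - (G i - 1 / u i)) / (l i / u i)) + - 1))"
proof -
  have fin: "finite I" unfolding I using K X by blast
  have "mlext I p x = (\<Sum>S\<in>Pow I. \<Psi> {t \<in> K. X t \<inter> S \<noteq> {}} * (\<Prod>i\<in>S. u i * (x i - G i)))"
    unfolding mlext_taylor[OF fin, of p x G]
  proof (intro sum.cong refl)
    fix S assume S: "S \<in> Pow I"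
    then have "finite S" using fin finite_subset by auto
    then have "(\<Prod>i\<in>S. u i) \<noteq> 0" using S u by auto
    then have "taylor_coeff I p G S = \<Psi> {t \<in> K. X t \<inter> S \<noteq> {}} * (\<Prod>i\<in>S. u i)"
      using coeff[of S] S by (simp add: field_simps)
    then show "taylor_coeff I p G S * (\<Prod>i\<in>S. x i - G i)
        = \<Psi> {t \<in> K. X t \<inter> S \<noteq> {}} * (\<Prod>i\<in>S. u i * (x i - G i))"
      by (simp add: prod.distrib)
  qed
  also have "\<dots> = (\<Sum>U\<in>Pow K. \<Psi> U * (\<Prod>t\<in>U. (\<Prod>i\<in>X t. 1 + u i * (x i - G i)) - 1))"
    unfolding I using K X disj by (rule sum_prod_blocks)
  also have "\<dots> = (\<Sum>U\<in>Pow K. \<Psi> U *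
      (\<Prod>t\<in>U. L t * (\<Prod>i\<in>X t. (x i - (G i - 1 / u i)) / (l i / u i)) + - 1))"
  proof (intro sum.cong refl arg_cong2[of _ _ _ _ "(*)"] prod.cong)
    fix U t assume "U \<in> Pow K" "t \<in> U"
    then have t: "t \<in> K" by auto
    have "(\<Prod>i\<in>X t. 1 + u i * (x i - G i))
        = (\<Prod>i\<in>X t. l i * ((x i - (G i - 1 / u i)) / (l i / u i)))"
    proof (intro prod.cong refl)
      fix i assume "i \<in> X t"
      then have "i \<in> I" using t I by blast
      then show "1 + u i * (x i - G i) = l i * ((x i - (G i - 1 / u i)) / (l i / u i))"
        using u[of i] l[of i] by (simp add: field_simps)
    qed
    then show "(\<Prod>i\<in>X t. 1 + u i * (x i - G i)) - 1
        = L t * (\<Prod>i\<in>X t. (x i - (G i - 1 / u i)) / (l i / u i)) + - 1"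
      using L[OF t] by (simp only: prod.distrib)
  qed
  finally show ?thesis .
qed

text \<open>The formula is already affine in every coordinate, so extending it from sign vectors
  gives it back at all real points.\<close>

lemma mlext_affine_products:
  assumes "finite K"
  shows "mlext K (\<lambda>q. \<Sum>U\<in>Pow K. \<Psi> U * (\<Prod>t\<in>U. L t * q t + \<beta> t)) q
    = (\<Sum>U\<in>Pow K. \<Psi> U * (\<Prod>t\<in>U. L t * q t + \<beta> t))"
proof (rule mlext_multiaffine[OF assms])
  show "multiaffine K (\<lambda>q. \<Sum>U\<in>Pow K. \<Psi> U * (\<Prod>t\<in>U. L t * q t + \<beta> t))"
    using assms by (intro multiaffine_sum multiaffine_cmult multiaffine_prod) (auto intro: finite_subset)
  show "depends_only K (\<lambda>q. \<Sum>U\<in>Pow K. \<Psi> U * (\<Prod>t\<in>U. L t * q t + \<beta> t))"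
    unfolding depends_only_def
  proof (intro allI impI sum.cong refl arg_cong2[of _ _ _ _ "(*)"] prod.cong)
    fix x y :: "'a \<Rightarrow> real" and U t assume "\<forall>i\<in>K. x i = y i" "U \<in> Pow K" "t \<in> U"
    then show "L t * x t + \<beta> t = L t * y t + \<beta> t" by auto
  qed
qed

text \<open>The formulas are identities of multilinear extensions at all real points; at sign
  vectors \<open>mlext_sign_cube\<close> turns them into formulas for the functions. With
  \<open>A\<close> and \<open>C\<close> nonzero the quotients are genuine, and the memberships in
  \<open>Z0\<close> ensure that \<open>\<kappa>\<close> is only read on \<open>Z0\<close>.\<close>

theorem theorem3p12:
  fixes n m :: nat
    and f g :: "nat \<Rightarrow> (nat \<Rightarrow> real) \<Rightarrow> real"
  assumes "ml_gen_polymorphism n m f g"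
    and "Dep {1..n} (f 0) = {1..n}"
    and "Dep {1..m} (g 0) = {1..m}"
    and "\<forall>j\<in>{0..m}. ml_degree {1..n} (f j) \<ge> 2"
    and "\<forall>i\<in>{0..n}. ml_degree {1..m} (g i) \<ge> 2"
    and "\<forall>j\<in>{1..m}. two_valued_like {1..n} (f j)"
    and "\<forall>i\<in>{1..n}. two_valued_like {1..m} (g i)"
  shows "\<exists>(Z0 :: (nat \<times> nat) set) (k :: nat) (Z :: nat \<Rightarrow> (nat \<times> nat) set)
            (h :: (nat \<Rightarrow> real) \<Rightarrow> real)
            (A :: nat \<Rightarrow> real) (B :: nat \<Rightarrow> real) (C :: nat \<Rightarrow> real) (D :: nat \<Rightarrow> real)
            (\<kappa> :: nat \<Rightarrow> nat \<Rightarrow> real).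
      Z0 \<subseteq> {1..n} \<times> {1..m} \<and>
      Z0 = (\<Union>t\<in>{1..k}. Z t) \<and>
      (\<forall>t\<in>{1..k}. Z t \<noteq> {}) \<and>
      (\<forall>s\<in>{1..k}. \<forall>t\<in>{1..k}. s \<noteq> t \<longrightarrow>
         Z s \<inter> Z t = {} \<and> fst ` Z s \<inter> fst ` Z t = {} \<and> snd ` Z s \<inter> snd ` Z t = {}) \<and>
      (\<forall>j\<in>{1..m}. A j \<noteq> 0) \<and>
      (\<forall>i\<in>{1..n}. C i \<noteq> 0) \<and>
      (\<forall>j\<in>{1..m}. \<forall>i\<in>Dep {1..n} (f j). (i, j) \<in> Z0) \<and>
      (\<forall>i\<in>{1..n}. \<forall>j\<in>Dep {1..m} (g i). (i, j) \<in> Z0) \<and>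
      (\<forall>x. mlext {1..n} (f 0) x =
             mlext {1..k} h (\<lambda>t. \<Prod>i\<in>fst ` Z t. (x i - D i) / C i)) \<and>
      (\<forall>j\<in>{1..m}. \<forall>x. mlext {1..n} (f j) x =
             A j * (\<Prod>i\<in>Dep {1..n} (f j). x i + \<kappa> i j) + B j) \<and>
      (\<forall>y. mlext {1..m} (g 0) y =
             mlext {1..k} h (\<lambda>t. \<Prod>j\<in>snd ` Z t. (y j - B j) / A j)) \<and>
      (\<forall>i\<in>{1..n}. \<forall>y. mlext {1..m} (g i) y =
             C i * (\<Prod>j\<in>Dep {1..m} (g i). y j + \<kappa> i j) + D i)"
proof -
  define I where "I = {1..n}"
  define J where "J = {1..m}"
  have fin: "finite I" "finite J" by (simp_all add: I_def J_def)
  note prems = assms[folded I_def J_def]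
  have deg: "ml_degree J (g i) \<ge> 2" if "i \<in> I" for i using that prems(5) by (simp add: I_def)
  have deg': "ml_degree I (f j) \<ge> 2" if "j \<in> J" for j using that prems(4) by (simp add: J_def)
  obtain z where z: "row_generic I J (f 0) g z" "row_generic J I (g 0) f (\<lambda>(j, i). z (i, j))"
  proof (rule generic_point[OF fin, of g f "f 0" "g 0"])
    show "Dep J (g i) \<noteq> {}" if "i \<in> I" for i by (rule ml_degree_ge_2_Dep[OF fin(2) deg[OF that]])
    show "Dep I (f j) \<noteq> {}" if "j \<in> J" for j by (rule ml_degree_ge_2_Dep[OF fin(1) deg'[OF that]])
  qed
  define G where "G i = mlext J (g i) (\<lambda>j. z (i, j))" for i
  define H where "H j = mlext I (f j) (\<lambda>i. z (i, j))" for j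
  define a where "a = taylor_coeff I (f 0) G"
  define b where "b i = taylor_coeff J (g i) (\<lambda>j. z (i, j))" for i
  define c where "c = taylor_coeff J (g 0) H"
  define d where "d j = taylor_coeff I (f j) (\<lambda>i. z (i, j))" for j
  \<comment> \<open>At the generic \<open>z\<close> a coefficient vanishes exactly off the complex
    of its function, so the locale assumptions reduce to facts about supports.\<close>
  have a: "a S \<noteq> 0 \<longleftrightarrow> below_supp I (f 0) S" if "S \<subseteq> I" for S
    using z(1) taylor_coeff_eq_0[OF that] unfolding row_generic_def a_def G_def[abs_def] by metis
  have b: "b i T \<noteq> 0 \<longleftrightarrow> below_supp J (g i) T" if "i \<in> I" "T \<subseteq> J" for i T
    using z(1) that(1) taylor_coeff_eq_0[OF that(2)] unfolding row_generic_def b_def by metis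
  have c: "c T \<noteq> 0 \<longleftrightarrow> below_supp J (g 0) T" if "T \<subseteq> J" for T
    using z(2) taylor_coeff_eq_0[OF that] unfolding row_generic_def c_def H_def[abs_def] by auto
  have d: "d j S \<noteq> 0 \<longleftrightarrow> below_supp I (f j) S" if "j \<in> J" "S \<subseteq> I" for j S
    using z(2) that(1) taylor_coeff_eq_0[OF that(2)] unfolding row_generic_def d_def by auto
  have b1: "b i {j} \<noteq> 0 \<longleftrightarrow> j \<in> Dep J (g i)" if "i \<in> I" "j \<in> J" for i j
    using b[of i "{j}"] that below_supp_singleton[OF fin(2)] by simp
  have d1: "d j {i} \<noteq> 0 \<longleftrightarrow> i \<in> Dep I (f j)" if "i \<in> I" "j \<in> J" for i j
    using d[of j "{i}"] that below_supp_singleton[OF fin(1)] by simp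
  have DepJ: "Dep J p \<subseteq> J" and DepI: "Dep I p \<subseteq> I" for p by (auto simp: Dep_def)

  interpret coefficient_system I J a b c d
  proof
    fix W :: "(nat \<times> nat) set" assume W: "W \<subseteq> I \<times> J"
    have "mlext I (f 0) (\<lambda>i. mlext J (g i) (\<lambda>j. y (i, j))) = mlext J (g 0) (\<lambda>j. mlext I (f j) (\<lambda>i. y (i, j)))" for y
      using polymorphism_everywhere[OF assms(1)] unfolding I_def J_def .
    from taylor_coeff_compare[OF fin this W, of z]
    show "a (fst ` W) * (\<Prod>i\<in>fst ` W. b i (W `` {i})) = c (snd ` W) * (\<Prod>j\<in>snd ` W. d j (W\<inverse> `` {j}))"
      by (simp add: a_def b_def c_def d_def G_def[abs_def] H_def[abs_def])
  next
    show "a {i} \<noteq> 0" if "i \<in> I" for i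
      using a[of "{i}"] that prems(2) below_supp_singleton[OF fin(1)] by simp
    show "c {j} \<noteq> 0" if "j \<in> J" for j
      using c[of "{j}"] that prems(3) below_supp_singleton[OF fin(2)] by simp
    show "b i T' \<noteq> 0" if "i \<in> I" "T \<subseteq> J" "T' \<subseteq> T" "b i T \<noteq> 0" for i T T'
      using b[OF that(1,2)] b[OF that(1) subset_trans[OF that(3,2)]] that(3,4) below_supp_mono
      by blast
    show "d j S' \<noteq> 0" if "j \<in> J" "S \<subseteq> I" "S' \<subseteq> S" "d j S \<noteq> 0" for j S S'
      using d[OF that(1,2)] d[OF that(1) subset_trans[OF that(3,2)]] that(3,4) below_supp_mono
      by blast
    show "\<exists>j'\<in>J. j' \<noteq> j \<and> b i {j, j'} \<noteq> 0" if ij: "i \<in> I" "j \<in> J" "b i {j} \<noteq> 0" for i j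
    proof -
      have "two_valued_like J (g i)" using ij prems(7) by blast
      from two_valued_like_pair[OF fin(2) this deg[OF ij(1)]]
      obtain j' where "j' \<in> J" "j' \<noteq> j" "below_supp J (g i) {j, j'}" using b1 ij by blast
      then show ?thesis using b[of i "{j, j'}"] ij by auto
    qed
    show "\<exists>i'\<in>I. i' \<noteq> i \<and> d j {i, i'} \<noteq> 0" if ij: "i \<in> I" "j \<in> J" "d j {i} \<noteq> 0" for i j
    proof -
      have "two_valued_like I (f j)" using ij prems(6) by blast
      from two_valued_like_pair[OF fin(1) this deg'[OF ij(2)]]
      obtain i' where "i' \<in> I" "i' \<noteq> i" "below_supp I (f j) {i, i'}" using d1 ij by blast
      then show ?thesis using d[of j "{i, i'}"] ij by auto
    qed
    show "\<exists>j\<in>J. b i {j} \<noteq> 0" if "i \<in> I" for i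
      using ml_degree_ge_2_Dep[OF fin(2) deg[OF that]] b1[OF that] DepJ by blast
    show "\<exists>i\<in>I. d j {i} \<noteq> 0" if "j \<in> J" for j
      using ml_degree_ge_2_Dep[OF fin(1) deg'[OF that]] d1 that DepI by blast
  qed (rule fin)+

  have Nrow: "Dep J (g i) = nbr_row i" if "i \<in> I" for i
    using b1[OF that] DepJ unfolding nbr_row_def by blast
  have Ncol: "Dep I (f j) = nbr_col j" if "j \<in> J" for j
    using d1 that DepI unfolding nbr_col_def by blast

  obtain u v k where u: "\<And>i. i \<in> I \<Longrightarrow> u i \<noteq> 0" and v: "\<And>j. j \<in> J \<Longrightarrow> v j \<noteq> 0"
    and k: "\<And>i j. i \<in> I \<Longrightarrow> j \<in> nbr_row i \<Longrightarrow> k i j \<noteq> 0"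
    and bT: "\<And>i T. i \<in> I \<Longrightarrow> T \<subseteq> nbr_row i \<Longrightarrow> T \<noteq> {} \<Longrightarrow> u i * b i T = (\<Prod>j\<in>T. k i j)"
    and dS: "\<And>j S. j \<in> J \<Longrightarrow> S \<subseteq> nbr_col j \<Longrightarrow> S \<noteq> {} \<Longrightarrow> v j * d j S = (\<Prod>i\<in>S. k i j)"
    and bal: "\<And>W. W \<subseteq> Sigma I nbr_row \<Longrightarrow>
      a (fst ` W) / (\<Prod>i\<in>fst ` W. u i) = c (snd ` W) / (\<Prod>j\<in>snd ` W. v j)"
    by (rule product_structure) (rule that)
  define E where "E = Sigma I nbr_row"
  have EIJ: "E \<subseteq> I \<times> J" unfolding E_def using nbr_row_sub by blast
  have finE: "finite E" using EIJ fin by (meson finite_SigmaI finite_subset)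
  have Erow: "E `` {i} = nbr_row i" if "i \<in> I" for i using that unfolding E_def by auto
  have Ecol: "E\<inverse> `` {j} = nbr_col j" if "j \<in> J" for j
    using nbr_iff that nbr_col_sub[of j] unfolding E_def by blast
  \<comment> \<open>No row or column is isolated, because every inner function depends on something;
    the blocks therefore cover all variables of \<open>f 0\<close> and \<open>g 0\<close>.\<close>
  have fstE: "fst ` E = I"
  proof -
    have "nbr_row i \<noteq> {}" if "i \<in> I" for i using b_ex[OF that] unfolding nbr_row_def by auto
    then show ?thesis unfolding E_def by force
  qed
  have sndE: "snd ` E = J"
  proof
    show "J \<subseteq> snd ` E"
    proof
      fix j assume j: "j \<in> J"
      then obtain i where "i \<in> I" "d j {i} \<noteq> 0" using d_ex by blast
      then have "(i, j) \<in> E" using nbr_iff[OF _ j] unfolding E_def nbr_col_def by auto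
      then show "j \<in> snd ` E" by force
    qed
  qed (use EIJ in auto)

  obtain K :: nat and X where cover: "(\<Union>t\<in>{1..K}. X t) = fst ` E"
    and ne: "\<And>t. t \<in> {1..K} \<Longrightarrow> X t \<noteq> {}"
    and disj: "\<And>s t. s \<in> {1..K} \<Longrightarrow> t \<in> {1..K} \<Longrightarrow> s \<noteq> t \<Longrightarrow> X s \<inter> X t = {}"
    and closed: "\<And>t i i' j. t \<in> {1..K} \<Longrightarrow> i \<in> X t \<Longrightarrow> (i, j) \<in> E \<Longrightarrow> (i', j) \<in> E \<Longrightarrow> i' \<in> X t"
    and conn: "\<And>t i i'. t \<in> {1..K} \<Longrightarrow> i \<in> X t \<Longrightarrow> i' \<in> X t \<Longrightarrow> (i, i') \<in> (E O E\<inverse>)\<^sup>*"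
    by (rule bipartite_components[OF finE]) (rule that)
  define Z where "Z t = {e \<in> E. fst e \<in> X t}" for t
  have XI: "X t \<subseteq> I" if "t \<in> {1..K}" for t using cover fstE that by blast
  have fstZ: "fst ` Z t = X t" if "t \<in> {1..K}" for t
    using XI[OF that] fstE unfolding Z_def by force
  have sndZ: "snd ` Z t = E `` X t" for t unfolding Z_def by force
  have disjcol: "E `` X s \<inter> E `` X t = {}" if st: "s \<in> {1..K}" "t \<in> {1..K}" "s \<noteq> t" for s t
  proof (rule ccontr)
    assume "E `` X s \<inter> E `` X t \<noteq> {}"
    then obtain i i' j where "i \<in> X s" "(i, j) \<in> E" "i' \<in> X t" "(i', j) \<in> E" by blast
    then have "i' \<in> X s \<inter> X t" using closed[OF st(1)] by blast
    then show False using disj[OF st] by blast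
  qed
  have cover_col: "J = (\<Union>t\<in>{1..K}. E `` X t)"
  proof -
    have "snd ` E = E `` (fst ` E)" by force
    also have "\<dots> = (\<Union>t\<in>{1..K}. E `` X t)" unfolding cover[symmetric] by blast
    finally show ?thesis using sndE by simp
  qed
  define \<phi> where "\<phi> S = a S / (\<Prod>i\<in>S. u i)" for S
  define \<chi> where "\<chi> T = c T / (\<Prod>j\<in>T. v j)" for T
  have bal\<phi>: "\<phi> (fst ` W) = \<chi> (snd ` W)" if "W \<subseteq> E" for W
    using bal that unfolding \<phi>_def \<chi>_def E_def .
  \<comment> \<open>The common value of both normalised outer coefficients on sets meeting exactly
    the blocks in \<open>U\<close>.\<close>
  define \<Psi> where "\<Psi> U = \<phi> (\<Union>t\<in>U. X t)" for U
  have \<phi>\<Psi>: "\<phi> S = \<Psi> {t \<in> {1..K}. X t \<inter> S \<noteq> {}}" if "S \<subseteq> I" for S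
    unfolding \<Psi>_def
  proof (rule balanced_block_function(1)[of E \<phi> \<chi> X "{1..K}"])
    show "S \<subseteq> fst ` E" using that fstE by simp
  qed (fact finE bal\<phi> cover closed conn)+
  have \<chi>\<Psi>: "\<chi> T = \<Psi> {t \<in> {1..K}. E `` X t \<inter> T \<noteq> {}}" if "T \<subseteq> J" for T
    unfolding \<Psi>_def
  proof (rule balanced_block_function(2)[of E \<phi> \<chi> X "{1..K}"])
    show "T \<subseteq> snd ` E" using that sndE by simp
  qed (fact finE bal\<phi> cover closed conn)+

  define l where "l i = (\<Prod>j\<in>nbr_row i. k i j)" for i
  define r where "r j = (\<Prod>i\<in>nbr_col j. k i j)" for j
  have l: "l i \<noteq> 0" if "i \<in> I" for i
    using k[OF that] finite_subset[OF nbr_row_sub fin(2)] unfolding l_def by simp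
  have r: "r j \<noteq> 0" if "j \<in> J" for j
  proof -
    have "k i j \<noteq> 0" if "i \<in> nbr_col j" for i using that k nbr_iff[OF _ \<open>j \<in> J\<close>] nbr_col_sub by blast
    then show ?thesis using finite_subset[OF nbr_col_sub fin(1)] unfolding r_def by simp
  qed
  \<comment> \<open>The product of \<open>k\<close> over all edges of a component can be taken by
    rows or by columns; this lets the same \<open>h\<close> serve \<open>f 0\<close> and
    \<open>g 0\<close>.\<close>
  define L where "L t = (\<Prod>(i, j)\<in>Z t. k i j)" for t
  have finZ: "finite (Z t)" for t using finE unfolding Z_def by simp
  have Lrow: "L t = (\<Prod>i\<in>X t. l i)" if "t \<in> {1..K}" for t
  proof -
    have "L t = (\<Prod>i\<in>X t. \<Prod>j\<in>Z t `` {i}. k i j)"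
      unfolding L_def prod_over_rows[OF finZ, symmetric] fstZ[OF that] ..
    also have "\<dots> = (\<Prod>i\<in>X t. l i)"
      unfolding l_def
    proof (intro prod.cong refl)
      fix i assume "i \<in> X t"
      then show "Z t `` {i} = nbr_row i" using Erow XI[OF that] unfolding Z_def by auto
    qed
    finally show ?thesis .
  qed
  have Lcol: "L t = (\<Prod>j\<in>E `` X t. r j)" if t: "t \<in> {1..K}" for t
  proof -
    have "L t = (\<Prod>j\<in>E `` X t. \<Prod>i\<in>(Z t)\<inverse> `` {j}. k i j)"
      unfolding L_def prod_over_cols[OF finZ, symmetric] sndZ ..
    also have "\<dots> = (\<Prod>j\<in>E `` X t. r j)"
      unfolding r_def
    proof (intro prod.cong refl)
      fix j assume j: "j \<in> E `` X t"
      then have "(Z t)\<inverse> `` {j} = E\<inverse> `` {j}" using closed[OF t] unfolding Z_def by auto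
      moreover have "j \<in> J" using j EIJ by blast
      ultimately show "(Z t)\<inverse> `` {j} = nbr_col j" using Ecol by simp
    qed
    finally show ?thesis .
  qed

  \<comment> \<open>The variable \<open>q t\<close> stands for the normalised product over block
    \<open>t\<close>, so \<open>L t * q t + - 1\<close> is the block increment from
    \<open>sum_prod_blocks\<close>.\<close>
  define h where "h q = (\<Sum>U\<in>Pow {1..K}. \<Psi> U * (\<Prod>t\<in>U. L t * q t + - 1))" for q :: "nat \<Rightarrow> real"
  have h: "mlext {1..K} h q = h q" for q
    unfolding h_def by (rule mlext_affine_products) simp
  \<comment> \<open>These constants are read off from \<open>mlext_product_form\<close>. Since
    \<open>k\<close> is shared by rows and columns, one \<open>\<kappa>\<close> fits both
    families.\<close>
  define A where "A j = r j / v j" for j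
  define B where "B j = H j - 1 / v j" for j
  define C where "C i = l i / u i" for i
  define D where "D i = G i - 1 / u i" for i
  define \<kappa> where "\<kappa> i j = 1 / k i j - z (i, j)" for i j

  have f0: "mlext I (f 0) x = mlext {1..K} h (\<lambda>t. \<Prod>i\<in>fst ` Z t. (x i - D i) / C i)" for x
  proof -
    have "mlext I (f 0) x = (\<Sum>U\<in>Pow {1..K}. \<Psi> U *
        (\<Prod>t\<in>U. L t * (\<Prod>i\<in>X t. (x i - (G i - 1 / u i)) / (l i / u i)) + - 1))"
    proof (rule mlext_block_form)
      show "finite (X t)" if "t \<in> {1..K}" for t using XI[OF that] fin(1) by (rule finite_subset)
      show "I = (\<Union>t\<in>{1..K}. X t)" using cover fstE by simp
      show "taylor_coeff I (f 0) G S / (\<Prod>i\<in>S. u i) = \<Psi> {t \<in> {1..K}. X t \<inter> S \<noteq> {}}"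
        if "S \<subseteq> I" for S using \<phi>\<Psi>[OF that] unfolding \<phi>_def a_def .
    qed (use disj u l Lrow in auto)
    also have "\<dots> = h (\<lambda>t. \<Prod>i\<in>fst ` Z t. (x i - D i) / C i)"
      unfolding h_def C_def D_def
      by (intro sum.cong refl arg_cong2[of _ _ _ _ "(*)"] prod.cong arg_cong2[of _ _ _ _ "(+)"])
        (rule fstZ[symmetric], blast)
    finally show ?thesis using h by simp
  qed
  have g0: "mlext J (g 0) y = mlext {1..K} h (\<lambda>t. \<Prod>j\<in>snd ` Z t. (y j - B j) / A j)" for y
  proof -
    have "mlext J (g 0) y = (\<Sum>U\<in>Pow {1..K}. \<Psi> U *
        (\<Prod>t\<in>U. L t * (\<Prod>j\<in>E `` X t. (y j - (H j - 1 / v j)) / (r j / v j)) + - 1))"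
    proof (rule mlext_block_form)
      show "finite (E `` X t)" for t using finE by (rule finite_Image)
      show "taylor_coeff J (g 0) H T / (\<Prod>j\<in>T. v j) = \<Psi> {t \<in> {1..K}. E `` X t \<inter> T \<noteq> {}}"
        if "T \<subseteq> J" for T using \<chi>\<Psi>[OF that] unfolding \<chi>_def c_def .
      show "J = (\<Union>t\<in>{1..K}. E `` X t)" by (rule cover_col)
      show "E `` X s \<inter> E `` X t = {}" if "s \<in> {1..K}" "t \<in> {1..K}" "s \<noteq> t" for s t
        by (rule disjcol[OF that])
    qed (use v r Lcol in auto)
    also have "\<dots> = h (\<lambda>t. \<Prod>j\<in>snd ` Z t. (y j - B j) / A j)"
      unfolding h_def A_def B_def sndZ ..
    finally show ?thesis using h by simp
  qed
  have gi: "mlext J (g i) y = C i * (\<Prod>j\<in>Dep J (g i). y j + \<kappa> i j) + D i" if "i \<in> I" for i y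
    unfolding Nrow[OF that] C_def l_def D_def G_def \<kappa>_def
  proof (rule mlext_product_form[OF fin(2) nbr_row_sub u[OF that]])
    show "k i j \<noteq> 0" if "j \<in> nbr_row i" for j using k \<open>i \<in> I\<close> that by blast
    show "u i * taylor_coeff J (g i) (\<lambda>j. z (i, j)) T = (\<Prod>j\<in>T. k i j)"
      if "T \<subseteq> nbr_row i" "T \<noteq> {}" for T using bT[OF \<open>i \<in> I\<close> that] unfolding b_def .
    show "taylor_coeff J (g i) (\<lambda>j. z (i, j)) T = 0" if "T \<subseteq> J" "\<not> T \<subseteq> nbr_row i" for T
      using nonzero_in_nbr_row[OF \<open>i \<in> I\<close> that(1)] that(2) unfolding b_def by blast
  qed
  have fj: "mlext I (f j) x = A j * (\<Prod>i\<in>Dep I (f j). x i + \<kappa> i j) + B j" if "j \<in> J" for j x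
    unfolding Ncol[OF that] A_def r_def B_def H_def \<kappa>_def
  proof (rule mlext_product_form[OF fin(1) nbr_col_sub v[OF that]])
    show "k i j \<noteq> 0" if "i \<in> nbr_col j" for i using that k nbr_iff[OF _ \<open>j \<in> J\<close>] nbr_col_sub by blast
    show "v j * taylor_coeff I (f j) (\<lambda>i. z (i, j)) S = (\<Prod>i\<in>S. k i j)"
      if "S \<subseteq> nbr_col j" "S \<noteq> {}" for S using dS[OF \<open>j \<in> J\<close> that] unfolding d_def .
    show "taylor_coeff I (f j) (\<lambda>i. z (i, j)) S = 0" if "S \<subseteq> I" "\<not> S \<subseteq> nbr_col j" for S
      using coefficient_system.nonzero_in_nbr_row[OF transpose, unfolded nbr_transpose, OF \<open>j \<in> J\<close> that(1)]
        that(2) unfolding d_def by blast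
  qed
  show ?thesis
    unfolding I_def[symmetric] J_def[symmetric]
  proof (rule exI[of _ E], rule exI[of _ K], rule exI[of _ Z], rule exI[of _ h], rule exI[of _ A],
      rule exI[of _ B], rule exI[of _ C], rule exI[of _ D], rule exI[of _ \<kappa>],
      intro conjI ballI allI impI)
    show "E = (\<Union>t\<in>{1..K}. Z t)"
    proof -
      have "(\<Union>t\<in>{1..K}. Z t) = {e \<in> E. fst e \<in> (\<Union>t\<in>{1..K}. X t)}" unfolding Z_def by blast
      then show ?thesis unfolding cover by blast
    qed
    show "Z t \<noteq> {}" if "t \<in> {1..K}" for t using fstZ[OF that] ne[OF that] by auto
    fix s t assume st: "s \<in> {1..K}" "t \<in> {1..K}" "s \<noteq> t"
    show "fst ` Z s \<inter> fst ` Z t = {}" using disj[OF st] fstZ st by simp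
    then show "Z s \<inter> Z t = {}" by blast
    show "snd ` Z s \<inter> snd ` Z t = {}" using disjcol[OF st] unfolding sndZ .
  next
    show "A j \<noteq> 0" if "j \<in> J" for j using r[OF that] v[OF that] unfolding A_def by simp
    show "C i \<noteq> 0" if "i \<in> I" for i using l[OF that] u[OF that] unfolding C_def by simp
    show "(i, j) \<in> E" if "j \<in> J" "i \<in> Dep I (f j)" for i j
      using that(2) Ecol[OF that(1)] unfolding Ncol[OF that(1)] by blast
    show "(i, j) \<in> E" if "i \<in> I" "j \<in> Dep J (g i)" for i j
      using that(2) Erow[OF that(1)] unfolding Nrow[OF that(1)] by blast
  qed (rule EIJ f0 g0 | (rule fj gi; assumption))+
qed

end
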